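(* Let $P$ be a poset with underlying set $[n]$. Then $P$ is a regular Schur labeled skew shape poset (i.e. $P\in\mathsf{RSP}_n$) if and only if $\Sigma_L(P)$ is dual plactic-closed.
   Context: $\mathfrak S_n$ is the symmetric group on $[n]=\{1,\dots,n\}$, with $s_i=(i,i+1)$. For $\sigma\in\mathfrak S_n$ and $1<i<n$: write $\sigma\overset1\cong\sigma s_i$ if $\sigma(i)<\sigma(i-1)<\sigma(i+1)$ or $\sigma(i+1)<\sigma(i-1)<\sigma(i)$; write $\sigma\overset2\cong\sigma s_{i-1}$ if $\sigma(i-1)<\sigma(i+1)<\sigma(i)$ or $\sigma(i)<\sigma(i+1)<\sigma(i-1)$. Knuth equivalence on $\mathfrak S_n$ is the equivalence relation generated by $\overset1\cong$ and $\overset2\cong$. Dual Knuth equivalence: $\sigma$ and $\rho$ are dual Knuth equivalent iff $\sigma^{-1}$ and $\rho^{-1}$ are Knuth equivalent. A subset $S\subseteq\mathfrak S_n$ is dual plactic-closed if it is a union of dual Knuth equivalence classes. A skew partition $\lambda/\mu$ is a pair of partitions with $\mu_i\le\lambda_i$ for all $i$ (missing parts are $0$); its Young diagram is the set of boxes $(i,j)$ (row $i$ counted from the top, column $j$ from the left) with $\mu_i<j\le\lambda_i$; its size is $|\lambda|-|\mu|$. Every skew partition is assumed basic: its Young diagram has no empty rows and no empty columns. A Schur labeling of shape $\lambda/\mu$ (of size $n$) is a filling of the Young diagram in which each element of $[n]$ appears exactly once, with rows decreasing from left to right and columns increasing from top to bottom. For such $\tau$, $\mathsf{poset}(\tau)$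 is the poset on $[n]$ with $i\preceq_\tau j$ iff the box of $i$ is weakly above and weakly left of the box of $j$ in $\tau$. $\mathsf{SP}_n$ (Schur labeled skew shape posets) is the set of all $\mathsf{poset}(\tau)$ with $\tau$ a Schur labeling of some skew shape of size $n$. A poset $P$ on $[n]$ is regular if for all $x,y,z\in[n]$ with $x\preceq_P z$ and ($x<y<z$ or $z<y<x$), one has $x\preceq_P y$ or $y\preceq_P z$. $\mathsf{RSP}_n$ is the set of regular posets in $\mathsf{SP}_n$. $\Sigma_L(P)=\{\sigma\in\mathfrak S_n\mid \sigma(i)\le\sigma(j)\text{ for all } i\preceq_P j\}$. *)

theory Defs
  imports "HOL-Combinatorics.Permutations"
begin

text \<open>
  The symmetric group on \<open>{1..n}\<close> consists of the functions \<open>\<sigma> :: nat \<Rightarrow> nat\<close> with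
  \<open>\<sigma> permutes {1..n}\<close> (which are the identity outside \<open>{1..n}\<close>). Right multiplication by
  the simple transposition \<open>s\<^sub>i\<close>, that is \<open>\<sigma> \<circ> transpose i (i + 1)\<close>, swaps the entries at
  the positions \<open>i\<close> and \<open>i + 1\<close> of the one-line notation of \<open>\<sigma>\<close>.
\<close>

definition sym_group :: "nat \<Rightarrow> (nat \<Rightarrow> nat) set" where
  "sym_group n = {\<sigma>. \<sigma> permutes {1..n}}"

definition knuth1 :: "nat \<Rightarrow> (nat \<Rightarrow> nat) \<Rightarrow> (nat \<Rightarrow> nat) \<Rightarrow> bool" where
  "knuth1 n \<sigma> \<rho> \<longleftrightarrow> \<sigma> \<in> sym_group n \<and>
     (\<exists>i. 1 < i \<and> i < n \<and> \<rho> = \<sigma> \<circ> transpose i (i + 1) \<and>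
        (\<sigma> i < \<sigma> (i - 1) \<and> \<sigma> (i - 1) < \<sigma> (i + 1) \<or>
         \<sigma> (i + 1) < \<sigma> (i - 1) \<and> \<sigma> (i - 1) < \<sigma> i))"

definition knuth2 :: "nat \<Rightarrow> (nat \<Rightarrow> nat) \<Rightarrow> (nat \<Rightarrow> nat) \<Rightarrow> bool" where
  "knuth2 n \<sigma> \<rho> \<longleftrightarrow> \<sigma> \<in> sym_group n \<and>
     (\<exists>i. 1 < i \<and> i < n \<and> \<rho> = \<sigma> \<circ> transpose (i - 1) i \<and>
        (\<sigma> (i - 1) < \<sigma> (i + 1) \<and> \<sigma> (i + 1) < \<sigma> i \<or>
         \<sigma> i < \<sigma> (i + 1) \<and> \<sigma> (i + 1) < \<sigma> (i - 1)))"

definition knuth_equiv :: "nat \<Rightarrow> (nat \<Rightarrow> nat) \<Rightarrow> (nat \<Rightarrow> nat) \<Rightarrow> bool" where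
  "knuth_equiv n = equivclp (\<lambda>\<sigma> \<rho>. knuth1 n \<sigma> \<rho> \<or> knuth2 n \<sigma> \<rho>)"

definition dual_knuth_rel :: "nat \<Rightarrow> (nat \<Rightarrow> nat) rel" where
  "dual_knuth_rel n =
     {(\<sigma>, \<rho>). \<sigma> \<in> sym_group n \<and> \<rho> \<in> sym_group n \<and> knuth_equiv n (inv \<sigma>) (inv \<rho>)}"

definition dual_plactic_closed :: "nat \<Rightarrow> (nat \<Rightarrow> nat) set \<Rightarrow> bool" where
  "dual_plactic_closed n S \<longleftrightarrow> (\<exists>\<C> \<subseteq> sym_group n // dual_knuth_rel n. S = \<Union>\<C>)"

definition is_partition :: "nat list \<Rightarrow> bool" where
  "is_partition xs \<longleftrightarrow> sorted_wrt (\<ge>) xs \<and> 0 \<notin> set xs"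

text \<open>Parts are indexed from 1; \<open>part xs i\<close> is 0 for \<open>i = 0\<close> and for missing parts.\<close>

definition part :: "nat list \<Rightarrow> nat \<Rightarrow> nat" where
  "part xs i = (if 1 \<le> i \<and> i \<le> length xs then xs ! (i - 1) else 0)"

text \<open>A box is a pair (row, column), with rows counted from the top and columns from the left.\<close>

definition young_diagram :: "nat list \<Rightarrow> nat list \<Rightarrow> (nat \<times> nat) set" where
  "young_diagram lam mu = {(i, j). part mu i < j \<and> j \<le> part lam i}"

definition skew_partition :: "nat list \<Rightarrow> nat list \<Rightarrow> bool" where
  "skew_partition lam mu \<longleftrightarrow>
     is_partition lam \<and> is_partition mu \<and> (\<forall>i. part mu i \<le> part lam i)"

definition basic :: "nat list \<Rightarrow> nat list \<Rightarrow> bool" where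
  "basic lam mu \<longleftrightarrow>
     (\<forall>i\<in>{1..length lam}. \<exists>j. (i, j) \<in> young_diagram lam mu) \<and>
     (\<forall>j\<in>{1..part lam 1}. \<exists>i. (i, j) \<in> young_diagram lam mu)"

definition skew_size :: "nat list \<Rightarrow> nat list \<Rightarrow> nat" where
  "skew_size lam mu = sum_list lam - sum_list mu"

text \<open>Only the values of a filling \<open>\<tau>\<close> on the boxes of the diagram are relevant.\<close>

definition schur_labeling ::
    "nat list \<Rightarrow> nat list \<Rightarrow> (nat \<times> nat \<Rightarrow> nat) \<Rightarrow> bool" where
  "schur_labeling lam mu \<tau> \<longleftrightarrow>
     bij_betw \<tau> (young_diagram lam mu) {1..skew_size lam mu} \<and>
     (\<forall>i j j'. (i, j) \<in> young_diagram lam mu \<and> (i, j') \<in> young_diagram lam mu \<and> j < j'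
        \<longrightarrow> \<tau> (i, j) > \<tau> (i, j')) \<and>
     (\<forall>i i' j. (i, j) \<in> young_diagram lam mu \<and> (i', j) \<in> young_diagram lam mu \<and> i < i'
        \<longrightarrow> \<tau> (i, j) < \<tau> (i', j))"

text \<open>Posets on \<open>{1..n}\<close> are relations \<open>P\<close> with \<open>partial_order_on {1..n} P\<close>,
  where \<open>(x, y) \<in> P\<close> means \<open>x \<preceq>\<^sub>P y\<close>.\<close>

definition labeling_poset ::
    "nat list \<Rightarrow> nat list \<Rightarrow> (nat \<times> nat \<Rightarrow> nat) \<Rightarrow> nat rel" where
  "labeling_poset lam mu \<tau> =
     {(\<tau> p, \<tau> q) | p q. p \<in> young_diagram lam mu \<and> q \<in> young_diagram lam mu \<and>
        fst p \<le> fst q \<and> snd p \<le> snd q}"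

definition SP :: "nat \<Rightarrow> nat rel set" where
  "SP n = {labeling_poset lam mu \<tau> | lam mu \<tau>.
     skew_partition lam mu \<and> basic lam mu \<and> skew_size lam mu = n \<and> schur_labeling lam mu \<tau>}"

definition regular_poset :: "nat \<Rightarrow> nat rel \<Rightarrow> bool" where
  "regular_poset n P \<longleftrightarrow>
     (\<forall>x\<in>{1..n}. \<forall>y\<in>{1..n}. \<forall>z\<in>{1..n}.
        (x, z) \<in> P \<and> (x < y \<and> y < z \<or> z < y \<and> y < x) \<longrightarrow> (x, y) \<in> P \<or> (y, z) \<in> P)"

definition RSP :: "nat \<Rightarrow> nat rel set" where
  "RSP n = {P \<in> SP n. regular_poset n P}"

definition Sigma_L :: "nat \<Rightarrow> nat rel \<Rightarrow> (nat \<Rightarrow> nat) set" where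
  "Sigma_L n P = {\<sigma> \<in> sym_group n. \<forall>(i, j)\<in>P. \<sigma> i \<le> \<sigma> j}"

end

theory Submission
  imports Defs
begin

text \<open>
  A permutation \<open>\<sigma>\<close> belongs to \<open>Sigma_L n P\<close> if and only if its inverse, read as a word, is a linear
  extension of \<open>P\<close>. So the question is when the linear extensions of \<open>P\<close> are closed under elementary
  Knuth moves. Such a move exchanges two neighbouring letters that have a third letter of
  intermediate value next to them, and it fails to preserve linear extensions exactly when the two
  letters are comparable. Closure is therefore a condition on those triples \<open>a b c\<close> that can occupy
  three successive places of a linear extension. The locale \<open>plactic_poset\<close> states this triple
  condition, and \<open>plactic_poset_iff_knuth_closed\<close> proves the equivalence.

  From the triple condition to a skew shape: call a cover a right step or a down step according to
  whether the label falls or rises. The triple condition makes \<open>P\<close> regular (\<open>regular\<close>), allows at most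
  one right and one down step into and out of each element, and completes every path
  consisting of a right and a down step to a square (\<open>squares\<close>). To turn this local picture into
  global coordinates one must exclude that squares glue to a spiral. Regularity does this: if
  incomparable elements are compared by their labels, in one direction or in the other, the result
  is two linear extensions of \<open>P\<close> whose intersection is \<open>P\<close> (\<open>ord1_trans\<close>). They are the row and
  the column reading order. The maximal chains of right steps are intervals of the first, so
  numbering these chains in reading order defines the row of an element, and columns arise in the
  same way from down steps. The squares show that a right step increases the column by exactly one
  (\<open>right_col\<close>) and that the rows are cut off as in a skew shape (\<open>Max_cells_antimono\<close>,
  \<open>Min_cells_antimono\<close>).

  From a regular Schur labeled skew shape to the triple condition: if \<open>a b c\<close> were a
  forbidden triple, regularity would give \<open>a \<preceq> c\<close>, and a corner of the rectangle spanned by two of the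
  three boxes would be a fourth element forced between them
  (\<open>no_ascending_triple\<close>).
\<close>

section \<open>Finite posets with integer labels\<close>

definition btw :: "int \<Rightarrow> int \<Rightarrow> int \<Rightarrow> bool" where
  "btw p q r \<longleftrightarrow> p < q \<and> q < r \<or> r < q \<and> q < p"

locale labelled_poset =
  fixes A :: "'a set" and P :: "'a rel" and v :: "'a \<Rightarrow> int"
  assumes finite_A: "finite A"
    and partial_order: "partial_order_on A P"
    and inj_v: "inj_on v A"
begin

abbreviation le (infix "\<preceq>" 50) where "x \<preceq> y \<equiv> (x, y) \<in> P"

definition cover (infix "\<lessdot>" 50) where
  "x \<lessdot> z \<longleftrightarrow> x \<preceq> z \<and> x \<noteq> z \<and> (\<forall>u. x \<preceq> u \<longrightarrow> u \<preceq> z \<longrightarrow> u = x \<or> u = z)"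

text \<open>
  Since labels decrease along the rows of a Schur labeling and increase down its columns, the
  label alone tells whether a cover is a step to the right or a step down.
\<close>

definition right (infix "\<rightarrow>\<^sub>r" 50) where "x \<rightarrow>\<^sub>r z \<longleftrightarrow> x \<lessdot> z \<and> v z < v x"
definition down (infix "\<rightarrow>\<^sub>d" 50) where "x \<rightarrow>\<^sub>d z \<longleftrightarrow> x \<lessdot> z \<and> v x < v z"

text \<open>
  These are the triples that occupy three successive places, in this order, in some linear
  extension: the order of the three does not contradict \<open>P\<close>, and nothing else is forced to stand
  between them.
\<close>

definition consecutive :: "'a \<Rightarrow> 'a \<Rightarrow> 'a \<Rightarrow> bool" where
  "consecutive a b c \<longleftrightarrow> {a, b, c} \<subseteq> A \<and> distinct [a, b, c] \<and>
     \<not> b \<preceq> a \<and> \<not> c \<preceq> b \<and> \<not> c \<preceq> a \<and>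
     (\<forall>p\<in>{a, b, c}. \<forall>q\<in>{a, b, c}. \<forall>u. p \<preceq> u \<longrightarrow> u \<preceq> q \<longrightarrow> u \<in> {a, b, c})"

definition interval :: "'a \<Rightarrow> 'a \<Rightarrow> 'a set" where
  "interval x z = {u. x \<preceq> u \<and> u \<preceq> z}"

lemma le_refl: "x \<in> A \<Longrightarrow> x \<preceq> x"
  using partial_order by (auto simp: partial_order_on_def preorder_on_def refl_on_def)

lemma le_trans: "x \<preceq> y \<Longrightarrow> y \<preceq> z \<Longrightarrow> x \<preceq> z"
  using partial_order by (auto simp: partial_order_on_def preorder_on_def dest: transD)

lemma le_antisym: "x \<preceq> y \<Longrightarrow> y \<preceq> x \<Longrightarrow> x = y"
  using partial_order by (auto simp: partial_order_on_def dest: antisymD)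

lemma le_carrier: "x \<preceq> y \<Longrightarrow> x \<in> A \<and> y \<in> A"
  using partial_order by (auto simp: partial_order_on_def preorder_on_def)

lemma v_eq: "x \<in> A \<Longrightarrow> y \<in> A \<Longrightarrow> v x = v y \<longleftrightarrow> x = y"
  using inj_v by (auto dest: inj_onD)

lemma finite_interval: "finite (interval x z)"
  using finite_A by (rule finite_subset[rotated]) (auto simp: interval_def dest: le_carrier)

lemma card_interval_less:
  assumes "a \<preceq> a'" "c' \<preceq> c" "a \<preceq> c" "a \<noteq> a' \<or> c' \<noteq> c"
  shows "card (interval a' c') < card (interval a c)"
proof (rule psubset_card_mono[OF finite_interval])
  have "interval a' c' \<subseteq> interval a c"
    using assms by (auto simp: interval_def intro: le_trans)
  moreover have "a \<in> interval a c" "c \<in> interval a c"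
    using assms le_refl le_carrier by (auto simp: interval_def)
  moreover have "a \<notin> interval a' c' \<or> c \<notin> interval a' c'"
    using assms le_antisym by (auto simp: interval_def)
  ultimately show "interval a' c' \<subset> interval a c" by blast
qed

lemma cover_le: "x \<lessdot> z \<Longrightarrow> x \<preceq> z" by (simp add: cover_def)
lemma cover_neq: "x \<lessdot> z \<Longrightarrow> x \<noteq> z" by (simp add: cover_def)
lemma cover_between: "x \<lessdot> z \<Longrightarrow> x \<preceq> u \<Longrightarrow> u \<preceq> z \<Longrightarrow> u = x \<or> u = z"
  by (simp add: cover_def)

lemma cover_cases: "x \<lessdot> z \<Longrightarrow> x \<rightarrow>\<^sub>r z \<or> x \<rightarrow>\<^sub>d z"
  using v_eq[of x z] le_carrier[of x z] by (auto simp: right_def down_def cover_def)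

lemma rightD: "x \<rightarrow>\<^sub>r z \<Longrightarrow> x \<lessdot> z" by (simp add: right_def)
lemma downD: "x \<rightarrow>\<^sub>d z \<Longrightarrow> x \<lessdot> z" by (simp add: down_def)

lemma lower_cover_above:
  assumes "x \<preceq> z" "x \<noteq> z"
  obtains y where "x \<preceq> y" "y \<lessdot> z"
  using assms
proof (induction "card (interval x z)" arbitrary: x thesis rule: less_induct)
  case less
  show ?case
  proof (cases "x \<lessdot> z")
    case True
    then show ?thesis using less.prems le_refl le_carrier by blast
  next
    case False
    then obtain u where u: "x \<preceq> u" "u \<preceq> z" "u \<noteq> x" "u \<noteq> z"
      using less.prems by (auto simp: cover_def)
    have "card (interval u z) < card (interval x z)"
      using card_interval_less[of x u z z] u less.prems le_refl le_carrier by blast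
    from less.hyps[OF this _ u(2,4)] show ?thesis
      using less.prems(1) le_trans[OF u(1)] by blast
  qed
qed

text \<open>
  Two symmetries cut down the case distinctions. Negating the labels reflects a diagram in its
  main diagonal and exchanges right and down; reversing the order and negating the labels rotates
  a diagram by half a turn, which reverses all steps but keeps their kind.
\<close>

lemma converse_labelled: "labelled_poset A (P\<inverse>) (\<lambda>x. - v x)"
  using finite_A partial_order inj_v
  by unfold_locales (auto simp: inj_on_def)

lemma mirror_labelled: "labelled_poset A P (\<lambda>x. - v x)"
  using finite_A partial_order inj_v
  by unfold_locales (auto simp: inj_on_def)

lemma mirror_simps:
  "labelled_poset.right P (\<lambda>x. - v x) = (\<rightarrow>\<^sub>d)"
  "labelled_poset.down P (\<lambda>x. - v x) = (\<rightarrow>\<^sub>r)"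
proof -
  interpret m: labelled_poset A P "\<lambda>x. - v x" by (rule mirror_labelled)
  show "m.right = (\<rightarrow>\<^sub>d)" "m.down = (\<rightarrow>\<^sub>r)"
    by (auto simp: fun_eq_iff m.right_def m.down_def right_def down_def)
qed

lemma converse_simps:
  "labelled_poset.cover (P\<inverse>) = (\<lambda>x z. z \<lessdot> x)"
  "labelled_poset.right (P\<inverse>) (\<lambda>x. - v x) = (\<lambda>x z. z \<rightarrow>\<^sub>r x)"
  "labelled_poset.down (P\<inverse>) (\<lambda>x. - v x) = (\<lambda>x z. z \<rightarrow>\<^sub>d x)"
  "labelled_poset.consecutive A (P\<inverse>) = (\<lambda>a b c. consecutive c b a)"
proof -
  interpret c: labelled_poset A "P\<inverse>" "\<lambda>x. - v x" by (rule converse_labelled)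
  show cover: "c.cover = (\<lambda>x z. z \<lessdot> x)"
    by (auto simp: fun_eq_iff c.cover_def cover_def)
  show "c.right = (\<lambda>x z. z \<rightarrow>\<^sub>r x)" "c.down = (\<lambda>x z. z \<rightarrow>\<^sub>d x)"
    by (auto simp: fun_eq_iff c.right_def c.down_def right_def down_def cover)
  show "c.consecutive = (\<lambda>a b c. consecutive c b a)"
    by (intro ext) (auto simp: c.consecutive_def consecutive_def)
qed

lemma upper_cover_below:
  assumes "x \<preceq> z" "x \<noteq> z"
  obtains y where "x \<lessdot> y" "y \<preceq> z"
proof -
  interpret c: labelled_poset A "P\<inverse>" "\<lambda>x. - v x" by (rule converse_labelled)
  show ?thesis using c.lower_cover_above[of z x] assms that by (auto simp: converse_simps)
qed

end

section \<open>Local structure of posets closed under Knuth moves\<close>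

text \<open>
  A Knuth move on \<open>a b c\<close> may exchange \<open>b\<close> and \<open>c\<close> if the label of \<open>a\<close> lies between theirs, and
  \<open>a\<close> and \<open>b\<close> if the label of \<open>c\<close> does. The two axioms say that no such move violates the order.
\<close>

locale plactic_poset = labelled_poset +
  assumes triple_right: "consecutive a b c \<Longrightarrow> b \<preceq> c \<Longrightarrow> \<not> btw (v b) (v a) (v c)"
    and triple_left: "consecutive a b c \<Longrightarrow> a \<preceq> b \<Longrightarrow> \<not> btw (v a) (v c) (v b)"
begin

lemma mirror: "plactic_poset A P (\<lambda>x. - v x)"
  using triple_right triple_left
  by (intro plactic_poset.intro mirror_labelled plactic_poset_axioms.intro) (auto simp: btw_def)

lemma converse: "plactic_poset A (P\<inverse>) (\<lambda>x. - v x)"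
  using triple_right triple_left
  by (intro plactic_poset.intro converse_labelled plactic_poset_axioms.intro)
    (auto simp: btw_def converse_simps)

text \<open>
  For a cover \<open>x \<lessdot> z\<close> violating the condition, \<open>y\<close> is incomparable to both, so \<open>y x z\<close> can be
  made consecutive and the Knuth move that exchanges \<open>x\<close> and \<open>z\<close> breaks the order. A violation by a
  longer interval descends to a shorter one: split at an element of its interior, and one half
  still has the label of \<open>y\<close> between its ends.
\<close>

lemma regular:
  assumes "x \<preceq> z" "y \<in> A" "btw (v x) (v y) (v z)"
  shows "x \<preceq> y \<or> y \<preceq> z"
  using assms(1,3)
proof (induction "card (interval x z)" arbitrary: x z rule: less_induct)
  case less
  have A: "x \<in> A" "z \<in> A" using less.prems le_carrier by auto
  show ?case
  proof (rule ccontr)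
    assume neg: "\<not> (x \<preceq> y \<or> y \<preceq> z)"
    have "x \<lessdot> z"
    proof (rule ccontr)
      assume "\<not> x \<lessdot> z"
      moreover have "x \<noteq> z" using less.prems by (auto simp: btw_def)
      ultimately obtain u where u: "x \<preceq> u" "u \<preceq> z" "u \<noteq> x" "u \<noteq> z"
        using less.prems by (auto simp: cover_def)
      have "v u \<noteq> v y" using v_eq[of u y] neg u le_carrier assms(2) by blast
      then have "btw (v x) (v y) (v u) \<or> btw (v u) (v y) (v z)"
        using less.prems(2) by (auto simp: btw_def)
      moreover have "card (interval x u) < card (interval x z)"
        using card_interval_less[of x x u z] u less.prems(1) A le_refl by blast
      moreover have "card (interval u z) < card (interval x z)"
        using card_interval_less[of x u z z] u less.prems(1) A le_refl by blast
      ultimately have "x \<preceq> y \<or> y \<preceq> u \<or> u \<preceq> y \<or> y \<preceq> z"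
        using less.hyps[of x u] less.hyps[of u z] u by blast
      then show False using neg u le_trans by blast
    qed
    have d: "x \<noteq> y" "z \<noteq> y" "x \<noteq> z" using less.prems by (auto simp: btw_def)
    have "\<not> z \<preceq> y" "\<not> y \<preceq> x" "\<not> z \<preceq> x"
      using neg less.prems(1) le_trans le_antisym d by blast+
    then have "consecutive y x z"
      unfolding consecutive_def using neg assms(2) A d
      by (auto dest: le_antisym le_trans cover_between[OF \<open>x \<lessdot> z\<close>])
    from triple_right[OF this less.prems(1)] less.prems(2) show False by simp
  qed
qed

text \<open>
  Two elements that cover \<open>x\<close> can directly follow \<open>x\<close> in either order; if both have a smaller
  label, one of these two words admits a Knuth move that breaks the order.
\<close>

lemma right_unique:
  assumes "x \<rightarrow>\<^sub>r z" "x \<rightarrow>\<^sub>r z'"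
  shows "z = z'"
proof (rule ccontr)
  assume neq: "z \<noteq> z'"
  have False if h: "x \<rightarrow>\<^sub>r y" "x \<rightarrow>\<^sub>r y'" "v y < v y'" for y y'
  proof -
    have c: "x \<lessdot> y" "x \<lessdot> y'" using h rightD by auto
    have d: "y \<noteq> y'" "x \<noteq> y" "x \<noteq> y'" using h cover_neq[OF c(1)] cover_neq[OF c(2)] by auto
    have l: "x \<preceq> y" "x \<preceq> y'" "x \<in> A" "y \<in> A" "y' \<in> A"
      using c cover_le le_carrier by blast+
    have n: "\<not> y \<preceq> y'" "\<not> y' \<preceq> y" "\<not> y \<preceq> x" "\<not> y' \<preceq> x"
      using cover_between[OF c(1)] cover_between[OF c(2)] l d le_antisym by blast+
    have "consecutive x y y'"
      unfolding consecutive_def using d l n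
      by (auto dest: le_antisym le_trans cover_between[OF c(1)] cover_between[OF c(2)])
    from triple_left[OF this l(1)] h show False by (auto simp: btw_def right_def)
  qed
  from this[of z z'] this[of z' z] neq assms v_eq[of z z'] show False
    by (metis cover_le le_carrier linorder_less_linear rightD)
qed

lemma right_unique_lower: "x \<rightarrow>\<^sub>r z \<Longrightarrow> x' \<rightarrow>\<^sub>r z \<Longrightarrow> x = x'"
  using plactic_poset.right_unique[OF converse] by (simp add: converse_simps)

lemma down_unique_lower: "x \<rightarrow>\<^sub>d z \<Longrightarrow> x' \<rightarrow>\<^sub>d z \<Longrightarrow> x = x'"
  using plactic_poset.right_unique_lower[OF mirror] by (simp add: mirror_simps)

text \<open>
  If \<open>a \<rightarrow>\<^sub>r b \<rightarrow>\<^sub>d c\<close> and nothing else lay between \<open>a\<close> and \<open>c\<close>, then \<open>a b c\<close> would be consecutive, with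
  the smallest label in the middle, and a Knuth move would break the order. So there is a detour
  from \<open>a\<close> to \<open>c\<close> avoiding \<open>b\<close>. By uniqueness of right and down neighbours it starts with a step
  \<open>a \<rightarrow>\<^sub>d d\<close> and ends with a step \<open>e \<rightarrow>\<^sub>r c\<close>. The final right step can be pushed to the beginning of the
  detour through smaller squares. If \<open>d \<rightarrow>\<^sub>r c\<close> fails, one more smaller square places an element
  strictly between \<open>b\<close> and \<open>c\<close>.
\<close>

lemma square_step:
  assumes IH: "\<And>a' b' c'. card (interval a' c') < card (interval a c) \<Longrightarrow>
      a' \<rightarrow>\<^sub>d b' \<Longrightarrow> b' \<rightarrow>\<^sub>r c' \<Longrightarrow> \<exists>d. a' \<rightarrow>\<^sub>r d \<and> d \<rightarrow>\<^sub>d c'"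
    and ab: "a \<rightarrow>\<^sub>r b" and bc: "b \<rightarrow>\<^sub>d c"
  shows "\<exists>d. a \<rightarrow>\<^sub>d d \<and> d \<rightarrow>\<^sub>r c"
proof -
  note cov = rightD[OF ab] downD[OF bc]
  note le = cover_le[OF cov(1)] cover_le[OF cov(2)]
  have ac: "a \<preceq> c" using le le_trans by blast
  have A: "a \<in> A" "b \<in> A" "c \<in> A" using le le_carrier by auto
  have d: "a \<noteq> b" "b \<noteq> c" "a \<noteq> c" using cov cover_neq le le_antisym by blast+
  have "\<exists>u. a \<preceq> u \<and> u \<preceq> c \<and> u \<notin> {a, b, c}"
  proof (rule ccontr)
    assume *: "\<not> ?thesis"
    have n: "\<not> b \<preceq> a" "\<not> c \<preceq> b" "\<not> c \<preceq> a" using le ac d le_antisym by blast+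
    have "consecutive a b c"
      unfolding consecutive_def
    proof (intro conjI ballI allI impI)
      fix p q u assume pq: "p \<in> {a, b, c}" "q \<in> {a, b, c}" "p \<preceq> u" "u \<preceq> q"
      have "a \<preceq> p" "q \<preceq> c" using pq A le ac le_refl by auto
      then have "a \<preceq> u" "u \<preceq> c" using pq le_trans by blast+
      then show "u \<in> {a, b, c}" using * by blast
    qed (use A d n in auto)
    moreover have "v b < v a" "v b < v c" "v a \<noteq> v c"
      using ab bc v_eq A d by (auto simp: right_def down_def)
    ultimately show False
      using triple_left[of a b c] triple_right[of a b c] le by (auto simp: btw_def)
  qed
  then obtain u where u: "a \<preceq> u" "u \<preceq> c" "u \<noteq> a" "u \<noteq> b" "u \<noteq> c" by blast
  obtain d where ad: "a \<lessdot> d" "d \<preceq> u" using upper_cover_below u by metis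
  have "d \<noteq> b" using cover_between[OF cov(2)] ad u by blast
  then have "a \<rightarrow>\<^sub>d d" using cover_cases[OF ad(1)] right_unique ab by blast
  obtain e where ec: "u \<preceq> e" "e \<lessdot> c" using lower_cover_above u by metis
  have "e \<noteq> b" using cover_between[OF cov(1)] ec u by blast
  then have "e \<rightarrow>\<^sub>r c" using cover_cases[OF ec(2)] down_unique_lower bc by blast
  have de: "d \<preceq> e" using ad ec le_trans by blast
  \<comment> \<open>Every element of the detour has a right step that stays below \<open>c\<close>, starting from \<open>e\<close> itself.\<close>
  have "\<exists>b'. a' \<rightarrow>\<^sub>r b' \<and> b' \<preceq> c" if "d \<preceq> a'" "a' \<preceq> e" for a'
    using that
  proof (induction "card (interval a' e)" arbitrary: a' rule: less_induct)
    case less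
    show ?case
    proof (cases "a' = e")
      case True
      then show ?thesis using \<open>e \<rightarrow>\<^sub>r c\<close> A le_refl by blast
    next
      case False
      then obtain d' where d': "a' \<lessdot> d'" "d' \<preceq> e" using upper_cover_below less.prems by metis
      show ?thesis
      proof (cases "a' \<rightarrow>\<^sub>r d'")
        case True
        then show ?thesis using d' ec cover_le le_trans by blast
      next
        case False
        then have a'd': "a' \<rightarrow>\<^sub>d d'" using cover_cases d' by blast
        have "card (interval d' e) < card (interval a' e)"
          using card_interval_less[of a' d' e e] d' less.prems cover_le cover_neq
            le_refl le_carrier by blast
        moreover have "d \<preceq> d'" using d' less.prems cover_le le_trans by blast
        ultimately obtain b' where b': "d' \<rightarrow>\<^sub>r b'" "b' \<preceq> c" using less.hyps d' by blast
        have "a \<preceq> a'" "a \<noteq> a'"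
          using ad less.prems cover_le cover_neq le_trans le_antisym by blast+
        then have "card (interval a' b') < card (interval a c)"
          using card_interval_less ac b' by blast
        from IH[OF this a'd' b'(1)] obtain g where "a' \<rightarrow>\<^sub>r g" "g \<rightarrow>\<^sub>d b'" by blast
        then show ?thesis using b' cover_le downD le_trans by blast
      qed
    qed
  qed
  then obtain b' where b': "d \<rightarrow>\<^sub>r b'" "b' \<preceq> c" using de le_refl le_carrier by blast
  show ?thesis
  proof (cases "b' = c")
    case True
    then show ?thesis using b' \<open>a \<rightarrow>\<^sub>d d\<close> by blast
  next
    case False
    then have "card (interval a b') < card (interval a c)"
      using card_interval_less[of a a b' c] ac b' A le_refl by blast
    from IH[OF this \<open>a \<rightarrow>\<^sub>d d\<close> b'(1)] obtain g where g: "a \<rightarrow>\<^sub>r g" "g \<rightarrow>\<^sub>d b'" by blast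
    then have "b \<lessdot> b'" using right_unique ab downD by blast
    then show ?thesis
      using cover_between[OF cov(2), of b'] b' False cover_le cover_neq by blast
  qed
qed

text \<open>
  Both kinds of squares have to be built in one induction, because completing a square of one
  kind uses smaller squares of the other kind.
\<close>

lemma squares:
  "(a \<rightarrow>\<^sub>r b \<longrightarrow> b \<rightarrow>\<^sub>d c \<longrightarrow> (\<exists>d. a \<rightarrow>\<^sub>d d \<and> d \<rightarrow>\<^sub>r c)) \<and>
   (a \<rightarrow>\<^sub>d b \<longrightarrow> b \<rightarrow>\<^sub>r c \<longrightarrow> (\<exists>d. a \<rightarrow>\<^sub>r d \<and> d \<rightarrow>\<^sub>d c))"
proof (induction "card (interval a c)" arbitrary: a b c rule: less_induct)
  case less
  interpret m: plactic_poset A P "\<lambda>x. - v x" by (rule mirror)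
  show ?case
    using square_step[of a c b] m.square_step[of a c b] less
    unfolding mirror_simps by blast
qed

lemma down_right_square: "a \<rightarrow>\<^sub>d b \<Longrightarrow> b \<rightarrow>\<^sub>r c \<Longrightarrow> \<exists>d. a \<rightarrow>\<^sub>r d \<and> d \<rightarrow>\<^sub>d c"
  using squares by blast

text \<open>
  If going from \<open>a\<close> up to \<open>c\<close> takes a right step at all, squares move that step to the front.
\<close>

lemma right_step_below:
  assumes "a \<preceq> c" "\<not> down\<^sup>*\<^sup>* a c"
  shows "\<exists>b. a \<rightarrow>\<^sub>r b \<and> b \<preceq> c"
  using assms
proof (induction "card (interval a c)" arbitrary: a rule: less_induct)
  case less
  have "a \<noteq> c" using less.prems by auto
  then obtain d where d: "a \<lessdot> d" "d \<preceq> c" using upper_cover_below less.prems by metis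
  show ?case
  proof (cases "a \<rightarrow>\<^sub>r d")
    case True
    then show ?thesis using d by blast
  next
    case False
    then have ad: "a \<rightarrow>\<^sub>d d" using cover_cases d by blast
    have "card (interval d c) < card (interval a c)"
      using card_interval_less[of a d c c] d less.prems cover_le cover_neq le_refl le_carrier
      by blast
    moreover have "\<not> down\<^sup>*\<^sup>* d c" using ad less.prems by (meson converse_rtranclp_into_rtranclp)
    ultimately obtain b' where "d \<rightarrow>\<^sub>r b'" "b' \<preceq> c" using less.hyps d by blast
    then show ?thesis using down_right_square[OF ad] cover_le downD le_trans by blast
  qed
qed

lemma right_step_above:
  assumes "a \<preceq> c" "\<not> down\<^sup>*\<^sup>* a c"
  shows "\<exists>b. a \<preceq> b \<and> b \<rightarrow>\<^sub>r c"
proof -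
  interpret c: plactic_poset A "P\<inverse>" "\<lambda>x. - v x" by (rule converse)
  have "c.down = down\<inverse>\<inverse>" by (auto simp: fun_eq_iff converse_simps)
  then have "c.down\<^sup>*\<^sup>* = (down\<^sup>*\<^sup>*)\<inverse>\<inverse>" by (simp only: rtranclp_conversep)
  then show ?thesis using c.right_step_below[of c a] assms by (auto simp: converse_simps)
qed

section \<open>Row and column coordinates\<close>

text \<open>
  The row reading order: rows from top to bottom, each row from left to right. If \<open>y\<close> lies
  strictly below and strictly left of \<open>x\<close>, the labels force \<open>v x < v y\<close> in a connected diagram;
  between different components regularity leaves the freedom to place them so that this holds too.
  Hence incomparable elements are compared by their labels.
\<close>

definition ord1 (infix "\<preceq>\<^sub>1" 50) where
  "x \<preceq>\<^sub>1 y \<longleftrightarrow> x \<in> A \<and> y \<in> A \<and> (x \<preceq> y \<or> \<not> y \<preceq> x \<and> v x < v y)"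

text \<open>
  A row of the diagram is a maximal chain of right steps, so it is counted by its first element.
\<close>

definition row_heads :: "'a set" where
  "row_heads = {h \<in> A. \<nexists>x. x \<rightarrow>\<^sub>r h}"

definition row :: "'a \<Rightarrow> nat" where
  "row x = card {h \<in> row_heads. h \<preceq>\<^sub>1 x}"

lemma ord1_refl: "x \<in> A \<Longrightarrow> x \<preceq>\<^sub>1 x"
  by (simp add: ord1_def le_refl)

lemma le_ord1: "x \<preceq> y \<Longrightarrow> x \<preceq>\<^sub>1 y"
  using le_carrier by (auto simp: ord1_def)

lemma ord1_antisym: "x \<preceq>\<^sub>1 y \<Longrightarrow> y \<preceq>\<^sub>1 x \<Longrightarrow> x = y"
  using le_antisym by (auto simp: ord1_def)

lemma ord1_linear: "x \<in> A \<Longrightarrow> y \<in> A \<Longrightarrow> x \<preceq>\<^sub>1 y \<or> y \<preceq>\<^sub>1 x"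
  using v_eq[of x y] le_refl[of x] by (auto simp: ord1_def)

text \<open>
  This is where regularity matters: a failure of transitivity would consist of a comparable pair
  and a third element that is incomparable to both although its label is between theirs.
\<close>

lemma ord1_trans:
  assumes "x \<preceq>\<^sub>1 y" "y \<preceq>\<^sub>1 z"
  shows "x \<preceq>\<^sub>1 z"
proof (rule ccontr)
  assume neg: "\<not> x \<preceq>\<^sub>1 z"
  have A: "x \<in> A" "y \<in> A" "z \<in> A" using assms by (auto simp: ord1_def)
  have zx: "z \<preceq>\<^sub>1 x" using neg ord1_linear A by blast
  have d: "x \<noteq> y" "y \<noteq> z" "x \<noteq> z" using neg assms A ord1_refl by auto
  have v: "v x \<noteq> v y" "v y \<noteq> v z" "v x \<noteq> v z" using v_eq A d by auto
  have r: "btw (v p) (v q) (v s) \<Longrightarrow> p \<preceq> s \<Longrightarrow> p \<preceq> q \<or> q \<preceq> s"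
    if "q \<in> A" for p q s using regular that by blast
  have n: "\<not> (p \<preceq> q \<and> q \<preceq> p)" if "p \<noteq> q" for p q using le_antisym that by blast
  have t: "p \<preceq> q \<Longrightarrow> q \<preceq> s \<Longrightarrow> p \<preceq> s" for p q s by (rule le_trans)
  consider "x \<preceq> y" | "y \<preceq> z" | "z \<preceq> x" | "v x < v y" "v y < v z" "v z < v x"
    using assms zx by (auto simp: ord1_def)
  then show False
  proof cases
    case 1
    then have "\<not> y \<preceq> z" "\<not> z \<preceq> y" "\<not> z \<preceq> x" "\<not> x \<preceq> z"
      using neg assms zx n d t le_ord1 unfolding ord1_def by blast+
    then have "v y < v z" "v z < v x" using assms zx by (auto simp: ord1_def)
    then show ?thesis using r[of z x y] A 1 \<open>\<not> z \<preceq> y\<close> \<open>\<not> x \<preceq> z\<close> by (auto simp: btw_def)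
  next
    case 2
    then have "\<not> x \<preceq> y" "\<not> y \<preceq> x" "\<not> z \<preceq> x" "\<not> x \<preceq> z"
      using neg assms zx n d t le_ord1 unfolding ord1_def by blast+
    then have "v x < v y" "v z < v x" using assms zx by (auto simp: ord1_def)
    then show ?thesis using r[of x y z] A 2 \<open>\<not> y \<preceq> x\<close> \<open>\<not> x \<preceq> z\<close> by (auto simp: btw_def)
  next
    case 3
    then have "\<not> x \<preceq> y" "\<not> y \<preceq> x" "\<not> z \<preceq> y" "\<not> y \<preceq> z"
      using neg assms zx n d t le_ord1 unfolding ord1_def by blast+
    then have "v x < v y" "v y < v z" using assms zx by (auto simp: ord1_def)
    then show ?thesis using r[of y z x] A 3 \<open>\<not> y \<preceq> x\<close> \<open>\<not> z \<preceq> y\<close> by (auto simp: btw_def)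
  qed auto
qed

lemma finite_row_heads: "finite row_heads"
  using finite_A by (simp add: row_heads_def)

lemma row_mono: "x \<preceq>\<^sub>1 y \<Longrightarrow> row x \<le> row y"
  unfolding row_def using finite_row_heads by (intro card_mono) (auto intro: ord1_trans)

text \<open>
  If \<open>u\<close> were read strictly between \<open>x\<close> and \<open>z\<close>, it would be incomparable to one of them, and by the
  labels not to both. Say it is incomparable to \<open>x\<close> and below \<open>z\<close>. The way from \<open>u\<close> to \<open>z\<close> must
  enter \<open>z\<close> by a down step \<open>y \<rightarrow>\<^sub>d z\<close>, as \<open>x\<close> is the only left neighbour of \<open>z\<close>.
  Then the label of \<open>x\<close> lies between those of \<open>u\<close> and \<open>y\<close> although \<open>x\<close> is incomparable to both, which contradicts regularity.
\<close>

lemma right_adjacent: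
  assumes "x \<rightarrow>\<^sub>r z" "x \<preceq>\<^sub>1 u" "u \<preceq>\<^sub>1 z"
  shows "u = x \<or> u = z"
proof (rule ccontr)
  assume "\<not> ?thesis"
  then have d: "u \<noteq> x" "u \<noteq> z" by auto
  note xz = rightD[OF assms(1)]
  have v: "v z < v x" using assms(1) by (simp add: right_def)
  have A: "u \<in> A" "x \<in> A" "z \<in> A" using assms by (auto simp: ord1_def)
  have "\<not> (x \<preceq> u \<and> u \<preceq> z)" using cover_between[OF xz] d by blast
  then consider "\<not> x \<preceq> u" "u \<preceq> z" | "x \<preceq> u" "\<not> u \<preceq> z" | "v x < v u" "v u < v z"
    using assms(2,3) by (auto simp: ord1_def)
  then show False
  proof cases
    case 1
    then have xu: "\<not> u \<preceq> x" "v x < v u" using assms(2) by (auto simp: ord1_def)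
    obtain y where y: "u \<preceq> y" "y \<lessdot> z" using lower_cover_above 1 d by metis
    have "y \<noteq> x" using y xu by blast
    then have "y \<rightarrow>\<^sub>d z" using cover_cases y right_unique_lower assms(1) by blast
    then have "btw (v u) (v x) (v y)" using xu v by (auto simp: btw_def down_def)
    then have "x \<preceq> y" using regular[OF y(1) A(2)] xu by blast
    then show ?thesis
      using cover_between[OF xz, of y] y \<open>y \<noteq> x\<close> cover_le cover_neq by blast
  next
    case 2
    then have zu: "\<not> z \<preceq> u" "v u < v z" using assms(3) by (auto simp: ord1_def)
    obtain y where y: "x \<lessdot> y" "y \<preceq> u" using upper_cover_below 2 d by metis
    have "y \<noteq> z" using y zu by blast
    then have "x \<rightarrow>\<^sub>d y" using cover_cases y right_unique assms(1) by blast
    then have "btw (v y) (v z) (v u)" using zu v by (auto simp: btw_def down_def)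
    then have "y \<preceq> z" using regular[OF y(2) A(3)] zu by blast
    then show ?thesis
      using cover_between[OF xz, of y] y \<open>y \<noteq> z\<close> cover_le cover_neq by blast
  qed (use v in auto)
qed

lemma right_row: "x \<rightarrow>\<^sub>r z \<Longrightarrow> row x = row z"
proof -
  assume r: "x \<rightarrow>\<^sub>r z"
  then have l: "x \<preceq> z" using rightD cover_le by blast
  have "{h \<in> row_heads. h \<preceq>\<^sub>1 x} = {h \<in> row_heads. h \<preceq>\<^sub>1 z}"
  proof (intro Collect_cong conj_cong refl iffI)
    fix h assume "h \<preceq>\<^sub>1 x" then show "h \<preceq>\<^sub>1 z" using ord1_trans le_ord1 l by blast
  next
    fix h assume h: "h \<in> row_heads" "h \<preceq>\<^sub>1 z"
    show "h \<preceq>\<^sub>1 x"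
    proof (rule ccontr)
      assume n: "\<not> h \<preceq>\<^sub>1 x"
      have "h \<in> A" "x \<in> A" using h l le_carrier by (auto simp: row_heads_def)
      then have "x \<preceq>\<^sub>1 h" using ord1_linear n by blast
      then show False using right_adjacent[OF r _ h(2)] n ord1_refl \<open>x \<in> A\<close> r h
        by (auto simp: row_heads_def)
    qed
  qed
  then show ?thesis by (simp add: row_def)
qed

text \<open>
  Descending from \<open>y\<close> in the reading order, no head of a row is met before \<open>x\<close>, so each element
  passed has a left neighbour, which is the element read just before it.
\<close>

lemma same_row:
  assumes "x \<preceq>\<^sub>1 y" "row x = row y"
  shows "right\<^sup>*\<^sup>* x y"
  using assms
proof (induction "card {u. u \<preceq>\<^sub>1 y}" arbitrary: y rule: less_induct)
  case less
  have A: "x \<in> A" "y \<in> A" using less.prems by (auto simp: ord1_def)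
  show ?case
  proof (cases "x = y")
    case False
    have "y \<notin> row_heads"
    proof
      assume h: "y \<in> row_heads"
      have "{h \<in> row_heads. h \<preceq>\<^sub>1 x} \<subset> {h \<in> row_heads. h \<preceq>\<^sub>1 y}"
        using h False less.prems(1) ord1_antisym ord1_refl[OF A(2)]
        by (auto intro: ord1_trans)
      then have "row x < row y"
        unfolding row_def using finite_row_heads by (intro psubset_card_mono) auto
      then show False using less.prems by simp
    qed
    then obtain z where z: "z \<rightarrow>\<^sub>r y" using A by (auto simp: row_heads_def)
    then have zy: "z \<preceq>\<^sub>1 y" "z \<noteq> y" using rightD cover_le cover_neq le_ord1 by blast+
    then have "z \<in> A" by (auto simp: ord1_def)
    then have xz: "x \<preceq>\<^sub>1 z"
      using ord1_linear[OF A(1)] right_adjacent[OF z _ less.prems(1)] False ord1_refl by blast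
    have "{u. u \<preceq>\<^sub>1 z} \<subset> {u. u \<preceq>\<^sub>1 y}"
      using zy ord1_antisym ord1_refl[OF A(2)] by (auto intro: ord1_trans)
    moreover have "finite {u. u \<preceq>\<^sub>1 y}"
      using finite_A by (rule finite_subset[rotated]) (auto simp: ord1_def)
    ultimately have "right\<^sup>*\<^sup>* x z"
      using less.hyps[of z] xz right_row[OF z] less.prems(2) psubset_card_mono by metis
    then show ?thesis using z by simp
  qed simp
qed

lemma right_chain:
  assumes "right\<^sup>*\<^sup>* x y" "x \<in> A"
  shows "x \<preceq> y \<and> row x = row y \<and> (x \<noteq> y \<longrightarrow> v y < v x)"
  using assms
proof (induction rule: rtranclp_induct)
  case (step y z)
  then show ?case
    using rightD[of y z] cover_le[of y z] right_row[of y z] le_trans[of x y z]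
    by (auto simp: right_def)
qed (simp add: le_refl)

lemma row_image: "row ` A = {1..card row_heads}"
proof
  show "row ` A \<subseteq> {1..card row_heads}"
  proof
    fix k assume "k \<in> row ` A"
    then obtain x where x: "x \<in> A" "k = row x" by blast
    have "\<exists>h\<in>row_heads. h \<preceq>\<^sub>1 x"
      using x(1)
    proof (induction "card {u. u \<preceq>\<^sub>1 x}" arbitrary: x rule: less_induct)
      case less
      show ?case
      proof (cases "x \<in> row_heads")
        case False
        then obtain z where z: "z \<rightarrow>\<^sub>r x" using less.prems by (auto simp: row_heads_def)
        then have zx: "z \<preceq>\<^sub>1 x" "z \<noteq> x" using rightD cover_le cover_neq le_ord1 by blast+
        have "{u. u \<preceq>\<^sub>1 z} \<subset> {u. u \<preceq>\<^sub>1 x}"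
          using zx ord1_antisym ord1_refl[OF less.prems] by (auto intro: ord1_trans)
        moreover have "finite {u. u \<preceq>\<^sub>1 x}"
          using finite_A by (rule finite_subset[rotated]) (auto simp: ord1_def)
        moreover have "z \<in> A" using zx by (auto simp: ord1_def)
        ultimately show ?thesis
          using less.hyps[of z] psubset_card_mono ord1_trans zx(1) by blast
      qed (use less.prems ord1_refl in blast)
    qed
    then have "{h \<in> row_heads. h \<preceq>\<^sub>1 x} \<noteq> {}" by blast
    then have "1 \<le> row x"
      unfolding row_def using finite_row_heads by (simp add: Suc_le_eq card_gt_0_iff)
    moreover have "row x \<le> card row_heads"
      unfolding row_def using finite_row_heads by (intro card_mono) auto
    ultimately show "k \<in> {1..card row_heads}" using x by simp
  qed
  note sub = this
  have inj: "inj_on row row_heads"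
  proof (rule inj_onI)
    \<comment> \<open>No right step ends in a head, so a chain of right steps into a head is trivial.\<close>
    have less: "h = h'" if "h \<preceq>\<^sub>1 h'" "row h = row h'" "h' \<in> row_heads" for h h'
      using same_row[OF that(1,2)] that(3)
      by (induction rule: rtranclp_induct) (auto simp: row_heads_def)
    fix h h' assume "h \<in> row_heads" "h' \<in> row_heads" "row h = row h'"
    then show "h = h'"
      using ord1_linear[of h h'] less[of h h'] less[of h' h] by (auto simp: row_heads_def)
  qed
  have "row ` row_heads = {1..card row_heads}"
  proof (rule card_subset_eq)
    show "row ` row_heads \<subseteq> {1..card row_heads}"
      using sub by (auto simp: row_heads_def)
    show "card (row ` row_heads) = card {1..card row_heads}"
      using card_image[OF inj] by simp
  qed simp
  then show "{1..card row_heads} \<subseteq> row ` A" by (auto simp: row_heads_def)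
qed

text \<open>
  Columns are the rows of the reflected poset.
\<close>

definition col where "col = plactic_poset.row A P (\<lambda>x. - v x)"
definition ord2 (infix "\<preceq>\<^sub>2" 50) where "ord2 = plactic_poset.ord1 A P (\<lambda>x. - v x)"

lemma ord2_iff: "x \<preceq>\<^sub>2 y \<longleftrightarrow> x \<in> A \<and> y \<in> A \<and> (x \<preceq> y \<or> \<not> y \<preceq> x \<and> v y < v x)"
proof -
  interpret m: plactic_poset A P "\<lambda>x. - v x" by (rule mirror)
  show ?thesis by (auto simp: ord2_def m.ord1_def)
qed

lemma ord2_linear: "x \<in> A \<Longrightarrow> y \<in> A \<Longrightarrow> x \<preceq>\<^sub>2 y \<or> y \<preceq>\<^sub>2 x"
  using plactic_poset.ord1_linear[OF mirror] by (simp add: ord2_def)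

lemma ord1_ord2_le: "x \<preceq>\<^sub>1 y \<Longrightarrow> x \<preceq>\<^sub>2 y \<Longrightarrow> x \<preceq> y"
  by (auto simp: ord1_def ord2_iff)

lemma col_mono: "x \<preceq>\<^sub>2 y \<Longrightarrow> col x \<le> col y"
  using plactic_poset.row_mono[OF mirror] by (simp add: ord2_def col_def)

lemma same_col: "x \<preceq>\<^sub>2 y \<Longrightarrow> col x = col y \<Longrightarrow> down\<^sup>*\<^sup>* x y"
  using plactic_poset.same_row[OF mirror] by (simp add: ord2_def col_def mirror_simps)

lemma down_chain:
  "down\<^sup>*\<^sup>* x y \<Longrightarrow> x \<in> A \<Longrightarrow> x \<preceq> y \<and> col x = col y \<and> (x \<noteq> y \<longrightarrow> v x < v y)"
  using plactic_poset.right_chain[OF mirror] by (simp add: col_def mirror_simps)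

lemma col_image: "\<exists>k. col ` A = {1..k}"
  using plactic_poset.row_image[OF mirror] by (auto simp: col_def)

text \<open>
  The row and column reading orders intersect in \<open>P\<close>. Ties need care: elements of one row form a
  chain of right steps with decreasing labels, elements of one column a chain of down steps with
  increasing labels, and a chain of both kinds is a single element.
\<close>

lemma le_iff:
  assumes "x \<in> A" "y \<in> A"
  shows "x \<preceq> y \<longleftrightarrow> row x \<le> row y \<and> col x \<le> col y"
proof
  assume "x \<preceq> y"
  then show "row x \<le> row y \<and> col x \<le> col y"
    using assms row_mono col_mono le_ord1 by (auto simp: ord2_iff)
next
  assume h: "row x \<le> row y \<and> col x \<le> col y"
  show "x \<preceq> y"
  proof (cases "x \<preceq>\<^sub>1 y")
    case True
    show ?thesis
    proof (cases "x \<preceq>\<^sub>2 y")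
      case True
      then show ?thesis using \<open>x \<preceq>\<^sub>1 y\<close> ord1_ord2_le by blast
    next
      case False
      then have "y \<preceq>\<^sub>2 x" using ord2_linear assms by blast
      then have "down\<^sup>*\<^sup>* y x" using same_col col_mono h by (metis order.antisym)
      then have "y \<preceq> x" using down_chain assms by blast
      then show ?thesis using \<open>x \<preceq>\<^sub>1 y\<close> ord1_antisym le_ord1 le_refl assms by metis
    qed
  next
    case False
    then have "y \<preceq>\<^sub>1 x" using ord1_linear assms by blast
    then have r: "right\<^sup>*\<^sup>* y x" using same_row row_mono h by (metis order.antisym)
    then have yx: "y \<preceq> x" using right_chain assms by blast
    then have "y \<preceq>\<^sub>2 x" using assms by (simp add: ord2_iff)
    then have "down\<^sup>*\<^sup>* y x" using same_col col_mono h by (metis order.antisym)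
    then have "x = y" using r right_chain[of y x] down_chain[of y x] assms by auto
    then show ?thesis using assms le_refl by blast
  qed
qed

lemma coordinates_inj: "x \<in> A \<Longrightarrow> y \<in> A \<Longrightarrow> row x = row y \<Longrightarrow> col x = col y \<Longrightarrow> x = y"
  using le_iff[of x y] le_iff[of y x] le_antisym by auto

lemma right_of:
  assumes "x \<in> A" "y \<in> A" "row x = row y" "col x \<le> col y"
  shows "right\<^sup>*\<^sup>* x y"
  using assms le_iff le_ord1 same_row by auto

lemma below:
  assumes "x \<in> A" "y \<in> A" "col x = col y" "row x \<le> row y"
  shows "down\<^sup>*\<^sup>* x y"
  using assms le_iff same_col by (auto simp: ord2_iff)

text \<open>
  If the column number jumped by more than one along \<open>x \<rightarrow>\<^sub>r z\<close>, an element \<open>h\<close> of the column next to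
  that of \<open>x\<close> would be read strictly between \<open>x\<close> and \<open>z\<close> in the column order. If \<open>h\<close> is comparable to
  \<open>x\<close> or \<open>z\<close>, the change of column produces a right step out of \<open>x\<close> or into \<open>z\<close>; it must be the
  given one, so \<open>h\<close> is beyond \<open>z\<close> or before \<open>x\<close>. If \<open>h\<close> is incomparable to both, its label
  contradicts regularity.
\<close>

lemma right_col:
  assumes "x \<rightarrow>\<^sub>r z"
  shows "col z = col x + 1"
proof -
  have xz: "x \<lessdot> z" "x \<preceq> z" "x \<noteq> z" "x \<in> A" "z \<in> A" "v z < v x"
    using assms rightD cover_le cover_neq le_carrier right_def by blast+
  have "col x \<noteq> col z"
    using coordinates_inj[of x z] xz right_row[OF assms] by auto
  then have less: "col x < col z" using le_iff[of x z] xz by auto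
  have "\<not> col x + 1 < col z"
  proof
    assume gap: "col x + 1 < col z"
    obtain k where k: "col ` A = {1..k}" using col_image by blast
    then have "col z \<in> {1..k}" using xz by blast
    then have "col x + 1 \<in> col ` A" unfolding k using gap by simp
    then obtain h where h: "h \<in> A" "col h = col x + 1" by force
    have o: "x \<preceq>\<^sub>2 h" "h \<preceq>\<^sub>2 z"
      using ord2_linear[of x h] ord2_linear[of h z] col_mono[of h x] col_mono[of z h] h xz gap
      by auto
    have d: "h \<noteq> x" "h \<noteq> z" using h gap by auto
    show False
    proof (cases "x \<preceq> h")
      case True
      have "\<not> down\<^sup>*\<^sup>* x h" using down_chain xz h by fastforce
      then obtain b where "x \<rightarrow>\<^sub>r b" "b \<preceq> h" using right_step_below True by blast
      then have "z \<preceq> h" using right_unique assms by blast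
      then show False using le_iff h xz gap by auto
    next
      case nx: False
      show False
      proof (cases "h \<preceq> z")
        case True
        have "\<not> down\<^sup>*\<^sup>* h z" using down_chain xz h gap by fastforce
        then obtain b where "h \<preceq> b" "b \<rightarrow>\<^sub>r z" using right_step_above True by blast
        then have "h \<preceq> x" using right_unique_lower assms by blast
        then show False using le_iff h xz by auto
      next
        case False
        then have "btw (v x) (v h) (v z)" using o nx by (auto simp: ord2_iff btw_def)
        then show False using regular xz h nx False by blast
      qed
    qed
  qed
  then show ?thesis using less by simp
qed

definition cells :: "nat \<Rightarrow> nat set" where
  "cells i = {col x | x. x \<in> A \<and> row x = i}"

lemma cells_finite: "finite (cells i)"
  using finite_A by (simp add: cells_def)

lemma cells_ordconvex:
  assumes "j \<in> cells i" "j' \<in> cells i" "j \<le> k" "k \<le> j'"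
  shows "k \<in> cells i"
proof -
  obtain x y where x: "x \<in> A" "row x = i" "col x = j" and y: "y \<in> A" "row y = i" "col y = j'"
    using assms by (auto simp: cells_def)
  have "right\<^sup>*\<^sup>* x y" using right_of x y assms by auto
  then have "k \<le> col y \<longrightarrow> k \<in> cells i"
  proof (induction rule: rtranclp_induct)
    case base
    then show ?case using x assms by (auto simp: cells_def)
  next
    case (step y z)
    have "row x = row z" "z \<in> A"
      using right_chain[of x z] step.hyps x(1) le_carrier[of x z]
      by (auto intro: rtranclp.rtrancl_into_rtrancl)
    then have "col z \<in> cells i" using x by (auto simp: cells_def)
    then show ?case using step.IH right_col[OF step.hyps(2)] by (auto simp: le_Suc_eq)
  qed
  then show ?thesis using y assms by simp
qed

text \<open>
  If a lower row extended further to the right, its last element would lie above, in \<open>P\<close>, the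
  last element \<open>x\<close> of the higher row but in another column, which yields a right step out of \<open>x\<close>.
\<close>

lemma Max_cells_antimono:
  assumes "i \<le> i'" "cells i \<noteq> {}" "cells i' \<noteq> {}"
  shows "Max (cells i') \<le> Max (cells i)"
proof (rule ccontr)
  assume n: "\<not> ?thesis"
  obtain x where x: "x \<in> A" "row x = i" "col x = Max (cells i)"
    using Max_in[OF cells_finite assms(2)] by (auto simp: cells_def)
  obtain z where z: "z \<in> A" "row z = i'" "col z = Max (cells i')"
    using Max_in[OF cells_finite assms(3)] by (auto simp: cells_def)
  have "x \<preceq> z" using le_iff x z n assms by auto
  moreover have "\<not> down\<^sup>*\<^sup>* x z" using down_chain x z n by fastforce
  ultimately obtain b where b: "x \<rightarrow>\<^sub>r b" using right_step_below by blast
  then have "col b \<in> cells i"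
    using right_row x le_carrier cover_le rightD by (auto simp: cells_def) metis
  then show False using Max_ge[OF cells_finite] right_col[OF b] x by fastforce
qed

lemma Min_cells_antimono:
  assumes "i \<le> i'" "cells i \<noteq> {}" "cells i' \<noteq> {}"
  shows "Min (cells i') \<le> Min (cells i)"
proof (rule ccontr)
  assume n: "\<not> ?thesis"
  obtain x where x: "x \<in> A" "row x = i" "col x = Min (cells i)"
    using Min_in[OF cells_finite assms(2)] by (auto simp: cells_def)
  obtain z where z: "z \<in> A" "row z = i'" "col z = Min (cells i')"
    using Min_in[OF cells_finite assms(3)] by (auto simp: cells_def)
  have "x \<preceq> z" using le_iff x z n assms by auto
  moreover have "\<not> down\<^sup>*\<^sup>* x z" using down_chain x z n by fastforce
  ultimately obtain b where b: "b \<rightarrow>\<^sub>r z" using right_step_above by blast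
  then have "col b \<in> cells i'"
    using right_row z le_carrier cover_le rightD by (auto simp: cells_def) metis
  then show False using Min_le[OF cells_finite] right_col[OF b] z by fastforce
qed

end

section \<open>Realization by a skew shape\<close>

text \<open>
  A partition has no zero parts, so the left boundary of a skew diagram is listed only as long as
  it is positive.
\<close>

lemma positive_initial_segment:
  fixes f :: "nat \<Rightarrow> nat"
  assumes "\<And>i j. 1 \<le> i \<Longrightarrow> i \<le> j \<Longrightarrow> j \<le> k \<Longrightarrow> f j \<le> f i"
  shows "\<exists>m\<le>k. \<forall>i\<in>{1..k}. 0 < f i \<longleftrightarrow> i \<le> m"
  using assms
proof (induction k)
  case (Suc k)
  show ?case
  proof (cases "0 < f (Suc k)")
    case True
    then have "0 < f i" if "i \<in> {1..Suc k}" for i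
      using Suc.prems[of i "Suc k"] that by auto
    then show ?thesis by (intro exI[of _ "Suc k"]) auto
  next
    case False
    obtain m where "m \<le> k" "\<forall>i\<in>{1..k}. 0 < f i \<longleftrightarrow> i \<le> m"
      using Suc.IH Suc.prems by (meson le_Suc_eq)
    then show ?thesis using False by (intro exI[of _ m]) (auto simp: le_Suc_eq)
  qed
qed simp

lemma part_map_upt: "part (map f [1..<Suc k]) i = (if i \<in> {1..k} then f i else 0)"
  by (auto simp: part_def simp del: upt_Suc)

lemma sum_list_map_upt: "sum_list (map f [1..<Suc k]) = (\<Sum>i=1..k. f i)"
  by (simp only: interv_sum_list_conv_sum_set_nat atLeastLessThanSuc_atLeastAtMost set_upt)

lemma is_partition_map_upt:
  assumes "\<And>i j. 1 \<le> i \<Longrightarrow> i \<le> j \<Longrightarrow> j \<le> k \<Longrightarrow> f j \<le> f i" "\<And>i. i \<in> {1..k} \<Longrightarrow> 0 < f i"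
  shows "is_partition (map f [1..<Suc k])"
  using assms
  by (force simp: is_partition_def sorted_wrt_iff_nth_less simp del: upt_Suc)

lemma skew_shape_with_row_bounds:
  fixes L M :: "nat \<Rightarrow> nat"
  assumes less: "\<And>i. i \<in> {1..k} \<Longrightarrow> M i < L i"
    and L: "\<And>i j. 1 \<le> i \<Longrightarrow> i \<le> j \<Longrightarrow> j \<le> k \<Longrightarrow> L j \<le> L i"
    and M: "\<And>i j. 1 \<le> i \<Longrightarrow> i \<le> j \<Longrightarrow> j \<le> k \<Longrightarrow> M j \<le> M i"
  obtains lam mu where "skew_partition lam mu" "length lam = k"
    "\<And>i. i \<in> {1..k} \<Longrightarrow> part lam i = L i"
    "young_diagram lam mu = (SIGMA i:{1..k}. {M i<..L i})"
    "skew_size lam mu = card (young_diagram lam mu)"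
proof -
  obtain m where m: "m \<le> k" "\<forall>i\<in>{1..k}. 0 < M i \<longleftrightarrow> i \<le> m"
    using positive_initial_segment M by metis
  define lam where "lam = map L [1..<Suc k]"
  define mu where "mu = map M [1..<Suc m]"
  have lam: "part lam i = (if i \<in> {1..k} then L i else 0)" for i
    unfolding lam_def by (rule part_map_upt)
  have mu: "part mu i = (if i \<in> {1..k} then M i else 0)" for i
    unfolding mu_def part_map_upt using m by auto
  have "is_partition lam"
    unfolding lam_def using L less by (intro is_partition_map_upt) fastforce+
  moreover have "is_partition mu"
    unfolding mu_def using M m by (intro is_partition_map_upt) auto
  moreover have "part mu i \<le> part lam i" for i
    using less[of i] by (cases "i \<in> {1..k}") (auto simp: lam mu)
  ultimately have skew: "skew_partition lam mu" by (simp add: skew_partition_def)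
  have yd: "young_diagram lam mu = (SIGMA i:{1..k}. {M i<..L i})"
    by (auto simp: young_diagram_def lam mu split: if_splits)
  have "sum_list mu = (\<Sum>i=1..m. M i)" unfolding mu_def by (rule sum_list_map_upt)
  also have "\<dots> = (\<Sum>i=1..k. M i)" using m by (intro sum.mono_neutral_left) auto
  finally have "skew_size lam mu = (\<Sum>i=1..k. L i) - (\<Sum>i=1..k. M i)"
    unfolding skew_size_def lam_def sum_list_map_upt by simp
  also have "\<dots> = (\<Sum>i=1..k. L i - M i)"
    using less by (intro sum_subtractf_nat[symmetric]) (simp add: less_imp_le)
  finally have "skew_size lam mu = card (young_diagram lam mu)"
    by (simp add: yd)
  with skew yd show ?thesis using lam by (intro that[of lam mu]) (auto simp: lam_def)
qed

context plactic_poset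
begin

lemma coordinates_image:
  "(\<lambda>x. (row x, col x)) ` A = (SIGMA i:{1..card row_heads}. {Min (cells i) - 1<..Max (cells i)})"
  (is "?f ` A = ?S")
proof
  obtain k where k: "col ` A = {1..k}" using col_image by blast
  show "?f ` A \<subseteq> ?S"
  proof
    fix p assume "p \<in> ?f ` A"
    then obtain x where x: "x \<in> A" "p = (row x, col x)" by blast
    have c: "col x \<in> cells (row x)" using x by (auto simp: cells_def)
    have "col x \<in> {1..k}" "row x \<in> {1..card row_heads}" using x k row_image by blast+
    moreover have "Min (cells (row x)) \<le> col x" "col x \<le> Max (cells (row x))"
      using c cells_finite by (auto intro: Min_le Max_ge)
    ultimately show "p \<in> ?S" using x by auto
  qed
  show "?S \<subseteq> ?f ` A"
  proof
    fix p assume "p \<in> ?S"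
    then obtain i j where p: "p = (i, j)" "i \<in> row ` A" "Min (cells i) - 1 < j" "j \<le> Max (cells i)"
      using row_image by auto
    then have ne: "cells i \<noteq> {}" by (auto simp: cells_def)
    have "j \<in> cells i"
      by (rule cells_ordconvex[OF Min_in[OF cells_finite ne] Max_in[OF cells_finite ne]])
        (use p in auto)
    then obtain x where "x \<in> A" "p = ?f x" using p by (auto simp: cells_def)
    then show "p \<in> ?f ` A" by blast
  qed
qed

lemma skew_coordinates:
  obtains lam mu where "skew_partition lam mu" "basic lam mu" "skew_size lam mu = card A"
    "bij_betw (\<lambda>x. (row x, col x)) A (young_diagram lam mu)"
proof -
  let ?f = "\<lambda>x. (row x, col x)" and ?k = "card row_heads"
  let ?M = "\<lambda>i. Min (cells i) - 1" and ?L = "\<lambda>i. Max (cells i)"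
  obtain l where l: "col ` A = {1..l}" using col_image by blast
  have ne: "cells i \<noteq> {}" if "i \<in> {1..?k}" for i
    using that unfolding row_image[symmetric] by (auto simp: cells_def)
  have pos: "0 < Min (cells i)" if i: "i \<in> {1..?k}" for i
  proof -
    have "cells i \<subseteq> {1..l}" using l by (auto simp: cells_def)
    then show ?thesis using Min_in[OF cells_finite ne[OF i]] by auto
  qed
  have "?M i < ?L i" if "i \<in> {1..?k}" for i
    using pos[OF that] Min_le[OF cells_finite Max_in[OF cells_finite ne[OF that]]] by linarith
  moreover have "?L j \<le> ?L i" "?M j \<le> ?M i" if "1 \<le> i" "i \<le> j" "j \<le> ?k" for i j
    using Max_cells_antimono[of i j] Min_cells_antimono[of i j] ne[of i] ne[of j] that
    by (auto intro: diff_le_mono)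
  ultimately obtain lam mu where lm: "skew_partition lam mu" "length lam = ?k"
    "\<And>i. i \<in> {1..?k} \<Longrightarrow> part lam i = ?L i"
    "young_diagram lam mu = (SIGMA i:{1..?k}. {?M i<..?L i})"
    "skew_size lam mu = card (young_diagram lam mu)"
    using skew_shape_with_row_bounds[of ?k ?M ?L] by blast
  have img: "?f ` A = young_diagram lam mu" by (simp only: coordinates_image lm(4))
  have bij: "bij_betw ?f A (young_diagram lam mu)"
    using img coordinates_inj by (auto simp: bij_betw_def inj_on_def)
  have "\<exists>j. (i, j) \<in> young_diagram lam mu" if "i \<in> {1..length lam}" for i
    using that unfolding lm(2) row_image[symmetric] img[symmetric] by auto
  moreover have "\<exists>i. (i, j) \<in> young_diagram lam mu" if j: "j \<in> {1..part lam 1}" for j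
  proof -
    have "1 \<in> {1..?k}" using j lm(2) by (auto simp: part_def split: if_splits)
    then have "part lam 1 \<in> cells 1" using lm(3) Max_in[OF cells_finite ne] by simp
    then have "part lam 1 \<in> col ` A" by (auto simp: cells_def)
    then have "j \<in> col ` A" using j l by auto
    then show ?thesis unfolding img[symmetric] by auto
  qed
  ultimately have "basic lam mu" by (auto simp: basic_def)
  with lm(1,5) bij show ?thesis using bij_betw_same_card[OF bij] by (intro that[of lam mu]) simp_all
qed

end

text \<open>
  The labeling is the inverse of the coordinate map. It decreases along rows and increases down
  columns because these are chains of right and of down steps.
\<close>

theorem plactic_poset_in_SP:
  assumes "plactic_poset {1..n} P int"
  shows "P \<in> SP n"
proof -
  interpret plactic_poset "{1..n}" P int by (rule assms)
  let ?f = "\<lambda>x. (row x, col x)"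
  obtain lam mu where lm: "skew_partition lam mu" "basic lam mu" "skew_size lam mu = n"
    and bij: "bij_betw ?f {1..n} (young_diagram lam mu)"
    using skew_coordinates by auto
  define \<tau> where "\<tau> = inv_into {1..n} ?f"
  have \<tau>bij: "bij_betw \<tau> (young_diagram lam mu) {1..n}"
    unfolding \<tau>_def by (rule bij_betw_inv_into[OF bij])
  have \<tau>: "\<tau> (i, j) \<in> {1..n}" "row (\<tau> (i, j)) = i" "col (\<tau> (i, j)) = j"
    if "(i, j) \<in> young_diagram lam mu" for i j
    using bij_betw_inv_into_right[OF bij that] bij_betwE[OF \<tau>bij] that by (auto simp: \<tau>_def)
  have \<tau>f: "\<tau> (row x, col x) = x" if "x \<in> {1..n}" for x
    using bij_betw_inv_into_left[OF bij that] by (simp add: \<tau>_def)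
  have "\<tau> (i, j') < \<tau> (i, j)"
    if "(i, j) \<in> young_diagram lam mu" "(i, j') \<in> young_diagram lam mu" "j < j'" for i j j'
    using right_chain[OF right_of, of "\<tau> (i, j)" "\<tau> (i, j')"] \<tau>[OF that(1)] \<tau>[OF that(2)] that(3)
    by fastforce
  moreover have "\<tau> (i, j) < \<tau> (i', j)"
    if "(i, j) \<in> young_diagram lam mu" "(i', j) \<in> young_diagram lam mu" "i < i'" for i i' j
    using down_chain[OF below, of "\<tau> (i, j)" "\<tau> (i', j)"] \<tau>[OF that(1)] \<tau>[OF that(2)] that(3)
    by fastforce
  ultimately have schur: "schur_labeling lam mu \<tau>"
    unfolding schur_labeling_def lm(3) using \<tau>bij by blast
  have "P = labeling_poset lam mu \<tau>"
  proof (intro set_eqI)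
    fix e :: "nat \<times> nat"
    obtain x y where e: "e = (x, y)" by (cases e)
    have "(x, y) \<in> P" if "(x, y) \<in> labeling_poset lam mu \<tau>"
      using that le_iff \<tau> by (fastforce simp: labeling_poset_def)
    moreover have "(x, y) \<in> labeling_poset lam mu \<tau>" if "(x, y) \<in> P"
    proof -
      have xy: "x \<in> {1..n}" "y \<in> {1..n}" using that le_carrier by blast+
      then have "?f x \<in> young_diagram lam mu" "?f y \<in> young_diagram lam mu"
        using bij_betwE[OF bij] by blast+
      then show ?thesis
        unfolding labeling_poset_def using le_iff[OF xy] that \<tau>f[OF xy(1)] \<tau>f[OF xy(2)]
        by (intro CollectI exI[of _ "?f x"] exI[of _ "?f y"]) auto
    qed
    ultimately show "e \<in> P \<longleftrightarrow> e \<in> labeling_poset lam mu \<tau>" using e by blast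
  qed
  then show ?thesis using lm schur by (auto simp: SP_def)
qed

section \<open>Regular Schur labeled skew shapes\<close>

text \<open>
  A regular Schur labeled skew shape, described by the row \<open>f\<close> and column \<open>g\<close> of each element. The
  coordinates are integers, so that a half turn can be expressed by negation.
\<close>

locale skew_poset = labelled_poset A P v
  for A :: "'a set" and P :: "'a rel" and v :: "'a \<Rightarrow> int" +
  fixes f g :: "'a \<Rightarrow> int"
  assumes le_iff: "x \<in> A \<Longrightarrow> y \<in> A \<Longrightarrow> x \<preceq> y \<longleftrightarrow> f x \<le> f y \<and> g x \<le> g y"
    and convex: "x \<in> A \<Longrightarrow> y \<in> A \<Longrightarrow> f x \<le> i \<Longrightarrow> i \<le> f y \<Longrightarrow> g x \<le> j \<Longrightarrow> j \<le> g y \<Longrightarrow>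
      \<exists>u\<in>A. f u = i \<and> g u = j"
    and row_decreasing: "x \<in> A \<Longrightarrow> y \<in> A \<Longrightarrow> f x = f y \<Longrightarrow> g x < g y \<Longrightarrow> v y < v x"
    and col_increasing: "x \<in> A \<Longrightarrow> y \<in> A \<Longrightarrow> g x = g y \<Longrightarrow> f x < f y \<Longrightarrow> v x < v y"
    and regular: "x \<preceq> z \<Longrightarrow> y \<in> A \<Longrightarrow> btw (v x) (v y) (v z) \<Longrightarrow> x \<preceq> y \<or> y \<preceq> z"
begin

lemma transposed: "skew_poset A P (\<lambda>x. - v x) g f"
proof (intro skew_poset.intro mirror_labelled skew_poset_axioms.intro)
  fix x y i j assume "x \<in> A" "y \<in> A" "g x \<le> i" "i \<le> g y" "f x \<le> j" "j \<le> f y"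
  then show "\<exists>u\<in>A. g u = i \<and> f u = j" using convex[of x y j i] by blast
next
  fix x y z assume "x \<preceq> z" "y \<in> A" "btw (- v x) (- v y) (- v z)"
  then show "x \<preceq> y \<or> y \<preceq> z" using regular[of x z y] by (auto simp: btw_def)
qed (use le_iff row_decreasing col_increasing in auto)

lemma rotated: "skew_poset A (P\<inverse>) (\<lambda>x. - v x) (\<lambda>x. - f x) (\<lambda>x. - g x)"
proof (intro skew_poset.intro converse_labelled skew_poset_axioms.intro)
  fix x y i j assume "x \<in> A" "y \<in> A" "- f x \<le> i" "i \<le> - f y" "- g x \<le> j" "j \<le> - g y"
  then have "\<exists>u\<in>A. f u = - i \<and> g u = - j" using convex[of y x "- i" "- j"] by linarith
  then show "\<exists>u\<in>A. - f u = i \<and> - g u = j" by force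
next
  fix x y z assume "(x, z) \<in> P\<inverse>" "y \<in> A" "btw (- v x) (- v y) (- v z)"
  then show "(x, y) \<in> P\<inverse> \<or> (y, z) \<in> P\<inverse>" using regular[of z x y] by (auto simp: btw_def)
qed (use le_iff row_decreasing col_increasing in auto)

text \<open>
  Regularity applied to \<open>b \<preceq> c\<close> gives \<open>a \<preceq> c\<close>, as \<open>a\<close> precedes \<open>b\<close>. Then \<open>b\<close> is in the column of \<open>c\<close>,
  since a corner of the rectangle spanned by \<open>b\<close> and \<open>c\<close> would otherwise be forced between them, and
  in one row their labels would decrease. By its label, \<open>a\<close> is in neither the row nor the column of
  \<open>c\<close>; so the corner in the row of \<open>c\<close> and the column of \<open>a\<close> is a fourth element between \<open>a\<close> and \<open>c\<close>.
\<close>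

lemma no_ascending_triple:
  assumes cons: "consecutive a b c" and bc: "b \<preceq> c" and v: "v b < v a" "v a < v c"
  shows False
proof -
  have A: "a \<in> A" "b \<in> A" "c \<in> A" and d: "a \<noteq> b" "b \<noteq> c" "a \<noteq> c" and nba: "\<not> b \<preceq> a"
    using cons by (auto simp: consecutive_def)
  have gap: "u \<in> {a, b, c}" if "p \<in> {a, b, c}" "p \<preceq> u" "u \<preceq> c" for p u
    using cons that by (auto simp: consecutive_def)
  have ac: "a \<preceq> c" using regular[OF bc A(1)] v nba by (auto simp: btw_def)
  have fg: "f b \<le> f c" "g b \<le> g c" "f a \<le> f c" "g a \<le> g c" using le_iff A bc ac by auto
  have gbc: "g b = g c"
  proof (rule ccontr)
    assume ne: "g b \<noteq> g c"
    obtain u where u: "u \<in> A" "f u = f b" "g u = g c" using convex[of b c] A fg by blast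
    then have "u \<in> {a, b, c}" using gap[of b u] le_iff A fg by auto
    moreover have "u \<noteq> a" using u nba le_iff A fg by auto
    ultimately have "f b = f c" using u ne by auto
    then show False using row_decreasing[of b c] A fg ne v by auto
  qed
  have "g a \<noteq> g c"
    using col_increasing[of a b] le_iff[of b a] A nba gbc v by (cases "f b \<le> f a") auto
  moreover have "f a \<noteq> f c"
    using row_decreasing[of a c] A fg v calculation by auto
  moreover obtain u where u: "u \<in> A" "f u = f c" "g u = g a" using convex[of a c] A fg by blast
  ultimately show False using gap[of a u] le_iff A fg gbc by auto
qed

text \<open>
  The four ways to violate the triple conditions correspond to each other under reflection and
  rotation.
\<close>

lemma plactic: "plactic_poset A P v"
proof (intro plactic_poset.intro labelled_poset_axioms plactic_poset_axioms.intro)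
  interpret t: skew_poset A P "\<lambda>x. - v x" g f by (rule transposed)
  fix a b c assume *: "consecutive a b c"
  show "\<not> btw (v b) (v a) (v c)" if "(b, c) \<in> P"
    using no_ascending_triple[OF * that] t.no_ascending_triple[OF * that]
    by (auto simp: btw_def)
  interpret r: skew_poset A "P\<inverse>" "\<lambda>x. - v x" "\<lambda>x. - f x" "\<lambda>x. - g x" by (rule rotated)
  interpret rt: skew_poset A "P\<inverse>" "\<lambda>x. - (- v x)" "\<lambda>x. - g x" "\<lambda>x. - f x"
    by (rule r.transposed)
  have *: "r.consecutive c b a" using * by (simp add: converse_simps)
  show "\<not> btw (v a) (v c) (v b)" if "(a, b) \<in> P"
    using r.no_ascending_triple[OF *] rt.no_ascending_triple[OF *] that
    by (auto simp: btw_def)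
qed

end

lemma part_antimono:
  assumes "is_partition xs" "1 \<le> i" "i \<le> j"
  shows "part xs j \<le> part xs i"
proof (cases "i = j")
  case False
  then have "i - 1 < j - 1" using assms by auto
  then show ?thesis
    using assms by (auto simp: part_def is_partition_def sorted_wrt_iff_nth_less)
qed simp

lemma young_diagram_convex:
  assumes "skew_partition lam mu" "(i, j) \<in> young_diagram lam mu" "(i', j') \<in> young_diagram lam mu"
    and "i \<le> k" "k \<le> i'" "j \<le> l" "l \<le> j'"
  shows "(k, l) \<in> young_diagram lam mu"
proof -
  have "1 \<le> i" using assms(2) by (cases i) (auto simp: young_diagram_def part_def)
  then have "part mu k \<le> part mu i" "part lam i' \<le> part lam k"
    using assms part_antimono by (auto simp: skew_partition_def)
  then show ?thesis using assms by (auto simp: young_diagram_def)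
qed

theorem RSP_plactic_poset:
  assumes "partial_order_on {1..n} P" "P \<in> RSP n"
  shows "plactic_poset {1..n} P int"
proof -
  obtain lam mu \<tau> where P: "P = labeling_poset lam mu \<tau>" and reg: "regular_poset n P"
    and skew: "skew_partition lam mu" and size: "skew_size lam mu = n"
    and schur: "schur_labeling lam mu \<tau>"
    using assms(2) by (auto simp: RSP_def SP_def)
  let ?Y = "young_diagram lam mu"
  define box where "box = inv_into ?Y \<tau>"
  have bij: "bij_betw \<tau> ?Y {1..n}" using schur size by (simp add: schur_labeling_def)
  have box: "box x \<in> ?Y" "\<tau> (box x) = x" if "x \<in> {1..n}" for x
    using bij_betw_inv_into_right[OF bij that] bij_betwE[OF bij_betw_inv_into[OF bij]] that
    by (auto simp: box_def)
  have box': "p \<in> ?Y \<Longrightarrow> \<tau> p \<in> {1..n} \<and> box (\<tau> p) = p" for p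
    using bij_betw_inv_into_left[OF bij] bij_betwE[OF bij] by (auto simp: box_def)
  have "skew_poset {1..n} P int (\<lambda>x. int (fst (box x))) (\<lambda>x. int (snd (box x)))"
  proof (intro skew_poset.intro labelled_poset.intro skew_poset_axioms.intro)
    fix x y :: nat assume xy: "x \<in> {1..n}" "y \<in> {1..n}"
    have "(x, y) \<in> P \<longleftrightarrow> fst (box x) \<le> fst (box y) \<and> snd (box x) \<le> snd (box y)"
    proof
      assume "(x, y) \<in> P"
      then show "fst (box x) \<le> fst (box y) \<and> snd (box x) \<le> snd (box y)"
        using box' unfolding P labeling_poset_def by auto
    next
      assume "fst (box x) \<le> fst (box y) \<and> snd (box x) \<le> snd (box y)"
      then show "(x, y) \<in> P"
        unfolding P labeling_poset_def using box[OF xy(1)] box[OF xy(2)]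
        by (intro CollectI exI[of _ "box x"] exI[of _ "box y"]) auto
    qed
    then show "(x, y) \<in> P \<longleftrightarrow> int (fst (box x)) \<le> int (fst (box y)) \<and>
        int (snd (box x)) \<le> int (snd (box y))" by simp
    obtain i j i' j' where ij: "box x = (i, j)" "box y = (i', j')" by (meson surj_pair)
    have Y: "(i, j) \<in> ?Y" "(i', j') \<in> ?Y" "\<tau> (i, j) = x" "\<tau> (i', j') = y"
      using box[OF xy(1)] box[OF xy(2)] ij by auto
    show "int y < int x"
      if "int (fst (box x)) = int (fst (box y))" "int (snd (box x)) < int (snd (box y))"
      using that schur Y ij unfolding schur_labeling_def by fastforce
    show "int x < int y"
      if "int (snd (box x)) = int (snd (box y))" "int (fst (box x)) < int (fst (box y))"
      using that schur Y ij unfolding schur_labeling_def by fastforce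
    fix k l :: int
    assume kl: "int (fst (box x)) \<le> k" "k \<le> int (fst (box y))"
      "int (snd (box x)) \<le> l" "l \<le> int (snd (box y))"
    then have "(nat k, nat l) \<in> ?Y"
      using young_diagram_convex[OF skew Y(1,2)] ij by auto
    then show "\<exists>u\<in>{1..n}. int (fst (box u)) = k \<and> int (snd (box u)) = l"
      using box'[of "(nat k, nat l)"] kl by (intro bexI[of _ "\<tau> (nat k, nat l)"]) auto
  next
    fix x y z assume h: "(x, z) \<in> P" "y \<in> {1..n}" "btw (int x) (int y) (int z)"
    then have "x \<in> {1..n}" "z \<in> {1..n}"
      using assms(1) by (auto simp: partial_order_on_def preorder_on_def)
    then show "(x, y) \<in> P \<or> (y, z) \<in> P"
      using reg h unfolding regular_poset_def btw_def by (metis of_nat_less_iff)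
  qed (use assms(1) in \<open>auto simp: inj_on_def\<close>)
  then show ?thesis by (rule skew_poset.plactic)
qed

theorem plactic_poset_RSP:
  assumes "plactic_poset {1..n} P int"
  shows "P \<in> RSP n"
proof -
  interpret plactic_poset "{1..n}" P int by (rule assms)
  have "regular_poset n P"
    unfolding regular_poset_def using regular by (auto simp: btw_def)
  then show ?thesis using plactic_poset_in_SP[OF assms] by (simp add: RSP_def)
qed

section \<open>Linear extensions and Knuth moves\<close>

definition linear_extension :: "nat \<Rightarrow> nat rel \<Rightarrow> (nat \<Rightarrow> nat) \<Rightarrow> bool" where
  "linear_extension n P w \<longleftrightarrow> w \<in> sym_group n \<and>
     (\<forall>p\<in>{1..n}. \<forall>q\<in>{1..n}. (w p, w q) \<in> P \<longrightarrow> p \<le> q)"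

lemma linear_extension_perm: "linear_extension n P w \<Longrightarrow> w \<in> sym_group n"
  by (simp add: linear_extension_def)

lemma linear_extension_le:
  "linear_extension n P w \<Longrightarrow> p \<in> {1..n} \<Longrightarrow> q \<in> {1..n} \<Longrightarrow> (w p, w q) \<in> P \<Longrightarrow> p \<le> q"
  unfolding linear_extension_def by blast

lemma sym_group_inv: "\<sigma> \<in> sym_group n \<Longrightarrow> inv \<sigma> \<in> sym_group n \<and> inv (inv \<sigma>) = \<sigma>"
  by (simp add: sym_group_def permutes_inv permutes_inv_inv)

lemma sym_group_transpose:
  "w \<in> sym_group n \<Longrightarrow> k \<in> {1..n} \<Longrightarrow> l \<in> {1..n} \<Longrightarrow> w \<circ> transpose k l \<in> sym_group n"
  by (simp add: sym_group_def permutes_compose permutes_swap_id)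

text \<open>
  The inverse of \<open>\<sigma>\<close>, as a word, lists the elements of \<open>P\<close> by increasing \<open>\<sigma>\<close>-value.
\<close>

lemma Sigma_L_iff_linear_extension:
  assumes "P \<subseteq> {1..n} \<times> {1..n}" "\<sigma> \<in> sym_group n"
  shows "\<sigma> \<in> Sigma_L n P \<longleftrightarrow> linear_extension n P (inv \<sigma>)"
proof -
  have \<sigma>: "\<sigma> permutes {1..n}" using assms(2) by (simp add: sym_group_def)
  have inv: "\<sigma> (inv \<sigma> p) = p" "inv \<sigma> (\<sigma> p) = p" for p
    using permutes_inverses[OF \<sigma>] by auto
  show ?thesis
  proof
    assume "\<sigma> \<in> Sigma_L n P"
    then have "p \<le> q" if "(inv \<sigma> p, inv \<sigma> q) \<in> P" for p q
      using that inv by (fastforce simp: Sigma_L_def)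
    then show "linear_extension n P (inv \<sigma>)"
      using sym_group_inv[OF assms(2)] by (simp add: linear_extension_def)
  next
    assume lin: "linear_extension n P (inv \<sigma>)"
    have "\<sigma> i \<le> \<sigma> j" if "(i, j) \<in> P" for i j
    proof -
      have "\<sigma> i \<in> {1..n}" "\<sigma> j \<in> {1..n}"
        using that assms(1) permutes_in_image[OF \<sigma>] by blast+
      moreover have "(inv \<sigma> (\<sigma> i), inv \<sigma> (\<sigma> j)) \<in> P" using that by (simp add: inv)
      ultimately show ?thesis by (rule linear_extension_le[OF lin])
    qed
    then show "\<sigma> \<in> Sigma_L n P" using assms(2) by (auto simp: Sigma_L_def)
  qed
qed

definition knuth_step where "knuth_step n \<sigma> \<rho> \<longleftrightarrow> knuth1 n \<sigma> \<rho> \<or> knuth2 n \<sigma> \<rho>"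

lemma knuth_step_sym: "knuth_step n \<sigma> \<rho> \<Longrightarrow> knuth_step n \<rho> \<sigma>"
proof -
  have "knuth1 n \<rho> \<sigma>" if "knuth1 n \<sigma> \<rho>"
  proof -
    obtain i where i: "\<sigma> \<in> sym_group n" "1 < i" "i < n" "\<rho> = \<sigma> \<circ> transpose i (i + 1)"
      "\<sigma> i < \<sigma> (i - 1) \<and> \<sigma> (i - 1) < \<sigma> (i + 1) \<or> \<sigma> (i + 1) < \<sigma> (i - 1) \<and> \<sigma> (i - 1) < \<sigma> i"
      using \<open>knuth1 n \<sigma> \<rho>\<close> by (auto simp: knuth1_def)
    have "\<rho> \<in> sym_group n" unfolding i(4) using i by (intro sym_group_transpose) auto
    moreover have "\<sigma> = \<rho> \<circ> transpose i (i + 1)" by (simp add: i(4) o_assoc[symmetric])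
    moreover have "\<rho> i = \<sigma> (i + 1)" "\<rho> (i + 1) = \<sigma> i" "\<rho> (i - 1) = \<sigma> (i - 1)"
      using i(2) by (auto simp: i(4) transpose_def)
    ultimately show ?thesis using i unfolding knuth1_def by metis
  qed
  moreover have "knuth2 n \<rho> \<sigma>" if "knuth2 n \<sigma> \<rho>"
  proof -
    obtain i where i: "\<sigma> \<in> sym_group n" "1 < i" "i < n" "\<rho> = \<sigma> \<circ> transpose (i - 1) i"
      "\<sigma> (i - 1) < \<sigma> (i + 1) \<and> \<sigma> (i + 1) < \<sigma> i \<or> \<sigma> i < \<sigma> (i + 1) \<and> \<sigma> (i + 1) < \<sigma> (i - 1)"
      using \<open>knuth2 n \<sigma> \<rho>\<close> by (auto simp: knuth2_def)
    have "\<rho> \<in> sym_group n" unfolding i(4) using i by (intro sym_group_transpose) auto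
    moreover have "\<sigma> = \<rho> \<circ> transpose (i - 1) i" by (simp add: i(4) o_assoc[symmetric])
    moreover have "\<rho> i = \<sigma> (i - 1)" "\<rho> (i - 1) = \<sigma> i" "\<rho> (i + 1) = \<sigma> (i + 1)"
      using i(2) by (auto simp: i(4) transpose_def)
    ultimately show ?thesis using i unfolding knuth2_def by metis
  qed
  moreover assume "knuth_step n \<sigma> \<rho>"
  ultimately show ?thesis by (auto simp: knuth_step_def)
qed

lemma knuth_step_sym_group: "knuth_step n \<sigma> \<rho> \<Longrightarrow> \<sigma> \<in> sym_group n \<and> \<rho> \<in> sym_group n"
proof -
  have "knuth_step n \<sigma> \<rho> \<Longrightarrow> \<sigma> \<in> sym_group n" for \<sigma> \<rho>
    by (auto simp: knuth_step_def knuth1_def knuth2_def)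
  then show "knuth_step n \<sigma> \<rho> \<Longrightarrow> \<sigma> \<in> sym_group n \<and> \<rho> \<in> sym_group n"
    using knuth_step_sym by blast
qed

lemma knuth_equiv_iff_rtranclp: "knuth_equiv n = (knuth_step n)\<^sup>*\<^sup>*"
proof -
  have step: "knuth_step n = (\<lambda>\<sigma> \<rho>. knuth1 n \<sigma> \<rho> \<or> knuth2 n \<sigma> \<rho>)"
    by (simp add: fun_eq_iff knuth_step_def)
  have "symclp (knuth_step n) = knuth_step n"
    using knuth_step_sym by (auto simp: fun_eq_iff symclp_def)
  then show ?thesis unfolding knuth_equiv_def equivclp_def step[symmetric] by simp
qed

lemma equiv_dual_knuth_rel: "equiv (sym_group n) (dual_knuth_rel n)"
proof (rule equivI)
  show "dual_knuth_rel n \<subseteq> sym_group n \<times> sym_group n" by (auto simp: dual_knuth_rel_def)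
  show "refl_on (sym_group n) (dual_knuth_rel n)"
    by (auto simp: refl_on_def dual_knuth_rel_def knuth_equiv_def)
  have "knuth_equiv n \<sigma> \<rho> \<Longrightarrow> knuth_equiv n \<rho> \<sigma>" for \<sigma> \<rho>
    unfolding knuth_equiv_def by (rule equivclp_sym)
  then show "sym (dual_knuth_rel n)"
    unfolding sym_def dual_knuth_rel_def by blast
  have "knuth_equiv n \<sigma> \<rho> \<Longrightarrow> knuth_equiv n \<rho> \<pi> \<Longrightarrow> knuth_equiv n \<sigma> \<pi>" for \<sigma> \<rho> \<pi>
    unfolding knuth_equiv_def by (rule equivclp_trans)
  then show "trans (dual_knuth_rel n)"
    unfolding trans_def dual_knuth_rel_def by blast
qed

lemma union_of_classes_iff:
  assumes "equiv X r"
  shows "(\<exists>\<C> \<subseteq> X // r. S = \<Union>\<C>) \<longleftrightarrow> S \<subseteq> X \<and> (\<forall>x\<in>S. \<forall>y. (x, y) \<in> r \<longrightarrow> y \<in> S)"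
proof
  assume "\<exists>\<C> \<subseteq> X // r. S = \<Union>\<C>"
  then show "S \<subseteq> X \<and> (\<forall>x\<in>S. \<forall>y. (x, y) \<in> r \<longrightarrow> y \<in> S)"
    using in_quotient_imp_subset[OF assms] in_quotient_imp_closed[OF assms] by blast
next
  assume S: "S \<subseteq> X \<and> (\<forall>x\<in>S. \<forall>y. (x, y) \<in> r \<longrightarrow> y \<in> S)"
  have "S = \<Union>((\<lambda>x. r `` {x}) ` S)"
    using S equiv_class_self[OF assms] by auto
  moreover have "(\<lambda>x. r `` {x}) ` S \<subseteq> X // r" using S by (auto intro: quotientI)
  ultimately show "\<exists>\<C> \<subseteq> X // r. S = \<Union>\<C>" by blast
qed

lemma dual_plactic_closed_iff:
  assumes "P \<subseteq> {1..n} \<times> {1..n}"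
  shows "dual_plactic_closed n (Sigma_L n P) \<longleftrightarrow>
    (\<forall>w w'. linear_extension n P w \<longrightarrow> knuth_step n w w' \<longrightarrow> linear_extension n P w')"
proof -
  have "dual_plactic_closed n (Sigma_L n P) \<longleftrightarrow>
    (\<forall>\<sigma>\<in>Sigma_L n P. \<forall>\<rho>. (\<sigma>, \<rho>) \<in> dual_knuth_rel n \<longrightarrow> \<rho> \<in> Sigma_L n P)"
    unfolding dual_plactic_closed_def union_of_classes_iff[OF equiv_dual_knuth_rel]
    by (auto simp: Sigma_L_def)
  also have "\<dots> \<longleftrightarrow> (\<forall>w w'. linear_extension n P w \<longrightarrow> knuth_step n w w' \<longrightarrow> linear_extension n P w')"
    (is "?L \<longleftrightarrow> ?R")
  proof
    assume L: ?L
    show ?R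
    proof (intro allI impI)
      fix w w' assume w: "linear_extension n P w" "knuth_step n w w'"
      then have sym: "w \<in> sym_group n" "w' \<in> sym_group n" using knuth_step_sym_group by blast+
      note inv = sym_group_inv[OF sym(1)] sym_group_inv[OF sym(2)]
      have "inv w \<in> Sigma_L n P" using Sigma_L_iff_linear_extension[OF assms] inv w by simp
      moreover have "(inv w, inv w') \<in> dual_knuth_rel n"
        using inv w by (auto simp: dual_knuth_rel_def knuth_equiv_iff_rtranclp)
      ultimately have "inv w' \<in> Sigma_L n P" using L by blast
      then show "linear_extension n P w'"
        using Sigma_L_iff_linear_extension[OF assms] inv by simp
    qed
  next
    assume R: ?R
    show ?L
    proof (intro ballI allI impI)
      fix \<sigma> \<rho> assume *: "\<sigma> \<in> Sigma_L n P" "(\<sigma>, \<rho>) \<in> dual_knuth_rel n"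
      then have sym: "\<sigma> \<in> sym_group n" "\<rho> \<in> sym_group n"
        and eq: "(knuth_step n)\<^sup>*\<^sup>* (inv \<sigma>) (inv \<rho>)"
        by (auto simp: dual_knuth_rel_def knuth_equiv_iff_rtranclp)
      have "linear_extension n P (inv \<sigma>)"
        using * sym Sigma_L_iff_linear_extension[OF assms] by blast
      with eq have "linear_extension n P (inv \<rho>)"
        by (induction rule: rtranclp_induct) (use R in blast)+
      then show "\<rho> \<in> Sigma_L n P" using sym Sigma_L_iff_linear_extension[OF assms] by blast
    qed
  qed
  finally show ?thesis .
qed

lemma linear_extension_swap:
  assumes w: "linear_extension n P w" and k: "1 \<le> k" "Suc k \<le> n" and nP: "(w k, w (Suc k)) \<notin> P"
  shows "linear_extension n P (w \<circ> transpose k (Suc k))"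
  unfolding linear_extension_def
proof (intro conjI ballI impI)
  let ?t = "transpose k (Suc k)"
  show "w \<circ> ?t \<in> sym_group n"
    using k by (intro sym_group_transpose linear_extension_perm[OF w]) auto
  fix p q assume pq: "p \<in> {1..n}" "q \<in> {1..n}" "((w \<circ> ?t) p, (w \<circ> ?t) q) \<in> P"
  have "?t p \<in> {1..n}" "?t q \<in> {1..n}" using pq(1,2) k by (auto simp: transpose_def)
  moreover have "(w (?t p), w (?t q)) \<in> P" using pq(3) by simp
  ultimately have le: "?t p \<le> ?t q" by (rule linear_extension_le[OF w])
  show "p \<le> q"
  proof (rule ccontr)
    assume "\<not> p \<le> q"
    then have "p = Suc k" "q = k" using le by (auto simp: transpose_def split: if_splits)
    then show False using pq(3) nP by simp
  qed
qed

text \<open>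
  Sorting by the number of elements below gives a linear extension.
\<close>

lemma (in labelled_poset) linear_extension_list:
  assumes "B \<subseteq> A"
  obtains xs where "distinct xs" "set xs = B" "sorted_wrt (\<lambda>x y. \<not> y \<preceq> x) xs"
proof -
  obtain ys where ys: "distinct ys" "set ys = B"
    using finite_distinct_list assms finite_A finite_subset by metis
  define key where "key x = card {u. u \<preceq> x}" for x
  define xs where "xs = sort_key key ys"
  have fin: "finite {u. u \<preceq> x}" for x
    using finite_A by (rule finite_subset[rotated]) (auto dest: le_carrier)
  have key: "key y < key x" if "y \<preceq> x" "y \<noteq> x" for x y
  proof -
    have "x \<in> A" using that le_carrier by blast
    then have "{u. u \<preceq> y} \<subset> {u. u \<preceq> x}"
      using that le_refl le_antisym le_trans by blast
    then show ?thesis unfolding key_def by (rule psubset_card_mono[OF fin])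
  qed
  have dist: "distinct xs" by (simp add: xs_def ys)
  have "sorted_wrt (\<lambda>x y. key x \<le> key y) xs"
    using sorted_sort_key[of key ys] by (simp add: xs_def sorted_wrt_map)
  then have "sorted_wrt (\<lambda>x y. \<not> y \<preceq> x) xs"
    unfolding sorted_wrt_iff_nth_less
    using key dist by (metis leD nth_eq_iff_index_eq order_less_trans order_less_irrefl)
  then show ?thesis using that[of xs] dist ys by (simp add: xs_def)
qed

text \<open>
  All other elements below one of the three can be read before them, and the remaining ones
  after them.
\<close>

lemma (in labelled_poset) consecutive_in_linear_extension_list:
  assumes "consecutive a b c"
  obtains xs ys where "distinct (xs @ [a, b, c] @ ys)" "set (xs @ [a, b, c] @ ys) = A"
    "sorted_wrt (\<lambda>x y. \<not> y \<preceq> x) (xs @ [a, b, c] @ ys)"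
proof -
  let ?T = "{a, b, c}"
  have T: "?T \<subseteq> A" and d: "distinct [a, b, c]" and n: "\<not> b \<preceq> a" "\<not> c \<preceq> b" "\<not> c \<preceq> a"
    and gap: "\<And>p q u. p \<in> ?T \<Longrightarrow> q \<in> ?T \<Longrightarrow> p \<preceq> u \<Longrightarrow> u \<preceq> q \<Longrightarrow> u \<in> ?T"
    using assms unfolding consecutive_def by blast+
  define D where "D = {u \<in> A - ?T. \<exists>t\<in>?T. u \<preceq> t}"
  define U where "U = A - ?T - D"
  obtain xs where xs: "distinct xs" "set xs = D" "sorted_wrt (\<lambda>x y. \<not> y \<preceq> x) xs"
    using linear_extension_list[of D] by (auto simp: D_def)
  obtain ys where ys: "distinct ys" "set ys = U" "sorted_wrt (\<lambda>x y. \<not> y \<preceq> x) ys"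
    using linear_extension_list[of U] by (auto simp: U_def)
  have TD: "\<not> t \<preceq> u" if "t \<in> ?T" "u \<in> D" for t u
    using that gap[of t _ u] by (auto simp: D_def)
  have UT: "\<not> u \<preceq> t" if "t \<in> ?T" "u \<in> U" for t u
    using that by (auto simp: D_def U_def)
  have UD: "\<not> u \<preceq> u'" if "u' \<in> D" "u \<in> U" for u u'
    using that UT le_trans unfolding D_def by blast
  have "distinct (xs @ [a, b, c] @ ys)"
    using xs ys d by (auto simp: D_def U_def)
  moreover have "set (xs @ [a, b, c] @ ys) = A"
    using xs ys T by (auto simp: D_def U_def)
  moreover have "sorted_wrt (\<lambda>x y. \<not> y \<preceq> x) (xs @ [a, b, c] @ ys)"
    using xs ys n TD UT UD by (auto simp: sorted_wrt_append)
  ultimately show ?thesis by (rule that)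
qed

lemma linear_extension_of_list:
  assumes xs: "distinct xs" "set xs = {1..n}" "sorted_wrt (\<lambda>x y. (y, x) \<notin> P) xs"
  shows "linear_extension n P (\<lambda>i. if i \<in> {1..n} then xs ! (i - 1) else i)"
proof -
  let ?w = "\<lambda>i. if i \<in> {1..n} then xs ! (i - 1) else i"
  have len: "length xs = n" using distinct_card[OF xs(1)] xs(2) by simp
  have "bij_betw (\<lambda>i. i - 1) {1..n} {..<n}"
    by (rule bij_betw_byWitness[where f' = Suc]) auto
  moreover have "bij_betw ((!) xs) {..<n} {1..n}"
    by (rule bij_betw_nth) (use xs len in auto)
  ultimately have "bij_betw ((!) xs \<circ> (\<lambda>i. i - 1)) {1..n} {1..n}" by (rule bij_betw_trans)
  then have "bij_betw ?w {1..n} {1..n}"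
    by (rule bij_betw_cong[THEN iffD1, rotated]) auto
  then have "?w permutes {1..n}" by (rule bij_imp_permutes) auto
  moreover have "p \<le> q" if "p \<in> {1..n}" "q \<in> {1..n}" "(?w p, ?w q) \<in> P" for p q
  proof (rule ccontr)
    assume "\<not> p \<le> q"
    then have "q - 1 < p - 1" "p - 1 < length xs" using that len by auto
    then have "(xs ! (p - 1), xs ! (q - 1)) \<notin> P" using xs(3) by (simp add: sorted_wrt_iff_nth_less)
    then show False using that by simp
  qed
  ultimately show ?thesis unfolding linear_extension_def sym_group_def by blast
qed

text \<open>
  Whatever is forced between two of the three entries has a position between theirs.
\<close>

lemma consecutive_entries:
  assumes "labelled_poset {1..n} P int" and w: "linear_extension n P w" and i: "1 < i" "i < n"
  shows "labelled_poset.consecutive {1..n} P (w (i - 1)) (w i) (w (i + 1))"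
proof -
  interpret labelled_poset "{1..n}" P int by (rule assms)
  have perm: "w permutes {1..n}" using linear_extension_perm[OF w] by (simp add: sym_group_def)
  note ord = linear_extension_le[OF w]
  have mem: "i - 1 \<in> {1..n}" "i \<in> {1..n}" "i + 1 \<in> {1..n}" using i by auto
  then have I: "{i - 1, i, i + 1} \<subseteq> {1..n}" by simp
  have neg: "\<not> w i \<preceq> w (i - 1)" "\<not> w (i + 1) \<preceq> w i" "\<not> w (i + 1) \<preceq> w (i - 1)"
    using ord[OF mem(2,1)] ord[OF mem(3,2)] ord[OF mem(3,1)] i by auto
  have inj: "w p = w q \<longleftrightarrow> p = q" for p q using permutes_inj[OF perm] by (auto dest: injD)
  have T: "{w (i - 1), w i, w (i + 1)} = w ` {i - 1, i, i + 1}" by auto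
  show ?thesis
    unfolding consecutive_def
  proof (intro conjI ballI allI impI)
    show "{w (i - 1), w i, w (i + 1)} \<subseteq> {1..n}"
      unfolding T using I permutes_image[OF perm] by blast
    fix p q u assume pq: "p \<in> {w (i - 1), w i, w (i + 1)}" "q \<in> {w (i - 1), w i, w (i + 1)}"
      "p \<preceq> u" "u \<preceq> q"
    then obtain k l where kl: "k \<in> {i - 1, i, i + 1}" "l \<in> {i - 1, i, i + 1}" "p = w k" "q = w l"
      unfolding T by blast
    obtain r where r: "r \<in> {1..n}" "u = w r"
      using le_carrier[OF pq(3)] permutes_image[OF perm] by blast
    have "k \<le> r" "r \<le> l" using ord[of k r] ord[of r l] kl r I pq by auto
    then have "r = i - 1 \<or> r = i \<or> r = i + 1" using kl by auto
    then show "u \<in> {w (i - 1), w i, w (i + 1)}" using r by auto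
  qed (use i neg in \<open>auto simp: inj\<close>)
qed

lemma btw_int: "btw (int p) (int q) (int r) \<longleftrightarrow> p < q \<and> q < r \<or> r < q \<and> q < p"
  by (simp add: btw_def)

text \<open>
  A Knuth move acts on three consecutive entries, and it keeps a linear extension a linear
  extension if and only if the exchanged entries are incomparable.
\<close>

theorem plactic_poset_iff_knuth_closed:
  assumes "partial_order_on {1..n} P"
  shows "plactic_poset {1..n} P int \<longleftrightarrow>
    (\<forall>w w'. linear_extension n P w \<longrightarrow> knuth_step n w w' \<longrightarrow> linear_extension n P w')"
proof -
  interpret labelled_poset "{1..n}" P int
    by unfold_locales (use assms in \<open>auto simp: inj_on_def\<close>)
  show ?thesis
  proof (intro iffI allI impI)
    fix w w' assume "plactic_poset {1..n} P int" and w: "linear_extension n P w" "knuth_step n w w'"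
    then interpret plactic_poset "{1..n}" P int by simp
    note cons = consecutive_entries[OF labelled_poset_axioms w(1)]
    consider "knuth1 n w w'" | "knuth2 n w w'" using w(2) by (auto simp: knuth_step_def)
    then show "linear_extension n P w'"
    proof cases
      case 1
      then obtain i where i: "1 < i" "i < n" "w' = w \<circ> transpose i (i + 1)"
        "btw (int (w i)) (int (w (i - 1))) (int (w (i + 1)))"
        unfolding knuth1_def btw_int by blast
      then show ?thesis
        using triple_right[OF cons] linear_extension_swap[OF w(1), of i] by auto
    next
      case 2
      then obtain i where i: "1 < i" "i < n" "w' = w \<circ> transpose (i - 1) i"
        "btw (int (w (i - 1))) (int (w (i + 1))) (int (w i))"
        unfolding knuth2_def btw_int by blast
      then have "1 \<le> i - 1" "Suc (i - 1) = i" by auto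
      then show ?thesis
        using i triple_left[OF cons] linear_extension_swap[OF w(1), of "i - 1"] by auto
    qed
  next
    assume closed: "\<forall>w w'. linear_extension n P w \<longrightarrow> knuth_step n w w' \<longrightarrow> linear_extension n P w'"
    have word: "\<exists>w i. linear_extension n P w \<and> 1 < i \<and> i < n \<and> w (i - 1) = a \<and> w i = b \<and> w (i + 1) = c"
      if cons: "consecutive a b c" for a b c
    proof -
      obtain xs ys where l: "distinct (xs @ [a, b, c] @ ys)" "set (xs @ [a, b, c] @ ys) = {1..n}"
        "sorted_wrt (\<lambda>x y. \<not> y \<preceq> x) (xs @ [a, b, c] @ ys)" (is "sorted_wrt _ ?l")
        using consecutive_in_linear_extension_list[OF cons] by blast
      have len: "length ?l = n" using distinct_card[OF l(1)] l(2) by simp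
      define w where "w = (\<lambda>i. if i \<in> {1..n} then ?l ! (i - 1) else i)"
      let ?i = "length xs + 2"
      have "linear_extension n P w" unfolding w_def by (rule linear_extension_of_list[OF l])
      moreover have "1 < ?i" "?i < n" "w (?i - 1) = a" "w ?i = b" "w (?i + 1) = c"
        using len by (auto simp: w_def nth_append)
      ultimately show ?thesis by blast
    qed
    show "plactic_poset {1..n} P int"
    proof (intro plactic_poset.intro labelled_poset_axioms plactic_poset_axioms.intro notI)
      fix a b c assume *: "consecutive a b c" "b \<preceq> c" "btw (int b) (int a) (int c)"
      then obtain w i where w: "linear_extension n P w" "1 < i" "i < n"
        "w (i - 1) = a" "w i = b" "w (i + 1) = c" using word by blast
      then have step: "knuth1 n w (w \<circ> transpose i (i + 1))"
        using * w unfolding knuth1_def btw_int using linear_extension_perm[OF w(1)] by blast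
      have lin: "linear_extension n P (w \<circ> transpose i (i + 1))"
        by (rule closed[rule_format, OF w(1)]) (use step in \<open>simp add: knuth_step_def\<close>)
      have "i + 1 \<le> i"
        by (rule linear_extension_le[OF lin]) (use * w in auto)
      then show False by simp
    next
      fix a b c assume *: "consecutive a b c" "a \<preceq> b" "btw (int a) (int c) (int b)"
      then obtain w i where w: "linear_extension n P w" "1 < i" "i < n"
        "w (i - 1) = a" "w i = b" "w (i + 1) = c" using word by blast
      then have step: "knuth2 n w (w \<circ> transpose (i - 1) i)"
        using * w unfolding knuth2_def btw_int using linear_extension_perm[OF w(1)] by blast
      have lin: "linear_extension n P (w \<circ> transpose (i - 1) i)"
        by (rule closed[rule_format, OF w(1)]) (use step in \<open>simp add: knuth_step_def\<close>)
      have "i \<le> i - 1"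
        by (rule linear_extension_le[OF lin]) (use * w in auto)
      then show False using w by simp
    qed
  qed
qed

section \<open>The characterization\<close>

theorem theorem6p4:
  fixes n :: nat and P :: "nat rel"
  assumes "partial_order_on {1..n} P"
  shows "P \<in> RSP n \<longleftrightarrow> dual_plactic_closed n (Sigma_L n P)"
proof -
  have "P \<subseteq> {1..n} \<times> {1..n}"
    using assms by (simp add: partial_order_on_def preorder_on_def)
  then show ?thesis
    using dual_plactic_closed_iff plactic_poset_iff_knuth_closed[OF assms]
      RSP_plactic_poset[OF assms] plactic_poset_RSP by blast
qed

end
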